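(* Let $\lambda_1=\frac{1+\sqrt5}{2}$ and $\kappa_1=\frac{2\log\lambda_1}{\log 2}$. (i) Let $x\in(0,1)$ be an irrational number such that the derivative $?'(x)$ exists and $?'(x)=0$. Then for any real function $\psi=\psi(t)$ satisfying $$\psi(t)\ge 0,\qquad \psi(t)=o\left(\frac{\log\log t}{\log t}\right),\quad t\to\infty,$$ there exists $T$ depending on $\psi$ such that for all $t\ge T$ one has $$\max_{u\le t}\left(S_x(u)-\kappa_1u\right)\ge\frac{\sqrt{2\log\lambda_1-\log2}}{\log2}\cdot\sqrt{t\log t}\cdot\left(1-t^{-\psi(t)}\right).$$ (ii) There exists an irrational $x\in(0,1)$ such that $?'(x)=0$ and for all $t$ large enough one has $$S_x(t)-\kappa_1t\le\frac{\sqrt{16\log\lambda_1-8\log2}}{\log2}\cdot\sqrt{t\log t}\cdot\left(1+2^5\left(\frac{\log\log t}{\log t}\right)\right).$$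
   Context: The Minkowski question mark function $?:[0,1]\to[0,1]$ is the continuous increasing function defined by $?(0)=0$, $?(1)=1$, by $?\left(\frac{p+p'}{q+q'}\right)=\frac12\left(?\left(\frac pq\right)+?\left(\frac{p'}{q'}\right)\right)$ for consecutive Farey fractions $\frac pq,\frac{p'}{q'}$, and extended by continuity to irrationals. Equivalently, for irrational $x=[0;a_1,a_2,\dots]$, $?(x)=\frac1{2^{a_1-1}}-\frac1{2^{a_1+a_2-1}}+\dots+\frac{(-1)^{n+1}}{2^{a_1+\dots+a_n-1}}+\cdots$. The derivative $?'(x)$ is the two-sided limit of $\frac{?(x+\delta)-?(x)}{\delta}$ as $\delta\to0$. For irrational $x\in(0,1)$ with regular continued fraction expansion $x=[0;a_1,a_2,\dots]$ (natural partial quotients), $S_x(t)=a_1+a_2+\dots+a_t$. Here $t,u$ range over natural numbers. *)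

theory Defs
  imports "HOL-Analysis.Analysis" "HOL-Library.Landau_Symbols"
begin

definition farey :: "nat \<Rightarrow> real set" where
  "farey n = {real p / real q | p q. 0 < q \<and> q \<le> n \<and> p \<le> q}"

(* Neighbours in some Farey sequence, in lowest terms: the mediant depends on the representation. *)
definition consecutive_farey :: "nat \<Rightarrow> nat \<Rightarrow> nat \<Rightarrow> nat \<Rightarrow> bool" where
  "consecutive_farey p q p' q' \<longleftrightarrow>
     0 < q \<and> 0 < q' \<and> coprime p q \<and> coprime p' q' \<and>
     real p / real q < real p' / real q' \<and>
     (\<exists>n. real p / real q \<in> farey n \<and> real p' / real q' \<in> farey n \<and>
          (\<forall>r\<in>farey n. \<not> (real p / real q < r \<and> r < real p' / real q')))"

definition is_question_mark :: "(real \<Rightarrow> real) \<Rightarrow> bool" where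
  "is_question_mark f \<longleftrightarrow>
     continuous_on {0..1} f \<and> mono_on {0..1} f \<and> f 0 = 0 \<and> f 1 = 1 \<and>
     (\<forall>p q p' q'. consecutive_farey p q p' q' \<longrightarrow>
        f (real (p + p') / real (q + q')) = (f (real p / real q) + f (real p' / real q')) / 2)"

(* The conditions determine the function on [0,1]; see is_question_mark_question_mark and
   question_mark_unique below. Its values elsewhere are unspecified. *)
definition question_mark :: "real \<Rightarrow> real" where
  "question_mark = (SOME f. is_question_mark f)"

(* Indexed so that x = [a_0; a_1, a_2, ...], hence a_0 = 0 for x in (0,1). *)
primrec complete_quotient :: "real \<Rightarrow> nat \<Rightarrow> real" where
  "complete_quotient x 0 = x"
| "complete_quotient x (Suc n) = 1 / frac (complete_quotient x n)"

definition partial_quotient :: "real \<Rightarrow> nat \<Rightarrow> int" where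
  "partial_quotient x n = \<lfloor>complete_quotient x n\<rfloor>"

definition pq_sum :: "real \<Rightarrow> nat \<Rightarrow> int" where
  "pq_sum x t = (\<Sum>i=1..t. partial_quotient x i)"

definition lambda1 :: real where
  "lambda1 = (1 + sqrt 5) / 2"

definition kappa1 :: real where
  "kappa1 = 2 * ln lambda1 / ln 2"


subsection \<open>Sanity facts on continued fractions\<close>

lemma complete_quotient_irrational:
  assumes "x \<notin> \<rat>"
  shows "complete_quotient x n \<notin> \<rat>"
proof (induction n)
  case 0
  then show ?case using assms by simp
next
  case (Suc n)
  let ?c = "complete_quotient x n"
  have "frac ?c \<notin> \<rat>"
  proof
    assume "frac ?c \<in> \<rat>"
    then have "frac ?c + of_int \<lfloor>?c\<rfloor> \<in> \<rat>" by (intro Rats_add Rats_of_int)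
    then show False using Suc by (simp add: frac_def)
  qed
  then show ?case
    by (metis Rats_divide Rats_1 complete_quotient.simps(2) div_by_1 divide_divide_eq_right mult_1)
qed

lemma complete_quotient_step:
  assumes "x \<notin> \<rat>"
  shows "complete_quotient x n =
           of_int (partial_quotient x n) + 1 / complete_quotient x (Suc n)"
  by (simp add: partial_quotient_def frac_def)

lemma partial_quotient_pos:
  assumes "x \<notin> \<rat>"
  shows "1 \<le> partial_quotient x (Suc n)"
proof -
  let ?c = "complete_quotient x n"
  have "frac ?c \<noteq> 0"
    using complete_quotient_irrational[OF assms, of n] by (auto simp: frac_eq_0_iff Ints_subset_Rats[THEN subsetD])
  moreover have "0 \<le> frac ?c" "frac ?c < 1" by (simp_all add: frac_lt_1)
  ultimately have "1 \<le> 1 / frac ?c" by simp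
  then show ?thesis by (simp add: partial_quotient_def)
qed


subsection \<open>Existence of the question mark function\<close>

lemma farey_det:
  assumes "consecutive_farey p q p' q'"
  shows "int p' * int q - int p * int q' = 1" "p' \<le> q'"
proof -
  from assms obtain n where q: "0 < q" "0 < q'" and cop: "coprime p q" "coprime p' q'"
    and lt: "real p / real q < real p' / real q'"
    and inF: "real p / real q \<in> farey n" "real p' / real q' \<in> farey n"
    and nob: "\<And>r. r \<in> farey n \<Longrightarrow> \<not> (real p / real q < r \<and> r < real p' / real q')"
    unfolding consecutive_farey_def by blast
  have red: "b \<le> n \<and> a \<le> b"
    if h: "real a / real b \<in> farey n" "coprime a b" "0 < b" for a b :: nat
  proof -
    obtain c d where cd: "real a / real b = real c / real d" "0 < d" "d \<le> n" "c \<le> d"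
      using h(1) unfolding farey_def by blast
    then have "real (a * d) = real (c * b)" using h(3) by (simp add: field_simps)
    then have e: "a * d = c * b" by (rule of_nat_eq_iff[THEN iffD1])
    then have "b dvd a * d" by simp
    then have "b dvd d" using h(2) by (simp add: coprime_dvd_mult_right_iff coprime_commute)
    then have "b \<le> n" using cd by (meson dvd_imp_le le_trans)
    moreover have "a * d \<le> d * b" using e cd(4) by simp
    then have "a \<le> b" using cd(2) by (simp add: mult.commute)
    ultimately show ?thesis by simp
  qed
  have b1: "q \<le> n" "p \<le> q" using red[OF inF(1) cop(1) q(1)] by auto
  have b2: "q' \<le> n" "p' \<le> q'" using red[OF inF(2) cop(2) q(2)] by auto
  show "p' \<le> q'" by (fact b2)
  have "real (p * q') < real (p' * q)" using lt q by (simp add: field_simps)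
  then have lt': "p * q' < p' * q" by (simp only: of_nat_less_iff)
  have pq: "p < q"
  proof (rule ccontr)
    assume "\<not> p < q"
    then have "p = q" using b1 by simp
    then have "q * q' < p' * q" using lt' by simp
    then show False using b2 q by simp
  qed
  obtain u0 v0 :: int where uv0: "u0 * int q - int p * v0 = 1"
  proof -
    obtain a b where "a * int q + b * int p = 1"
      using bezout_int[of "int q" "int p"] cop(1) by (metis coprime_commute coprime_iff_gcd_eq_1 coprime_int_iff)
    then have "a * int q - int p * (- b) = 1" by (simp add: algebra_simps)
    then show ?thesis by (rule that)
  qed
  define k where "k = (int n - v0) div int q"
  define u where "u = u0 + k * int p"
  define v where "v = v0 + k * int q"
  have uv: "u * int q - int p * v = 1" using uv0 by (simp add: u_def v_def algebra_simps)
  have kk: "int n - v0 = k * int q + (int n - v0) mod int q" by (simp add: k_def)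
  have v1: "v \<le> int n" using kk pos_mod_sign[of "int q" "int n - v0"] q(1) unfolding v_def by linarith
  have v2: "int n < v + int q" using kk pos_mod_bound[of "int q" "int n - v0"] q(1) unfolding v_def by linarith
  have v0: "0 < v" using v2 b1 by linarith
  have u0: "0 \<le> u"
  proof (rule ccontr)
    assume "\<not> 0 \<le> u"
    then have "u * int q \<le> 0" using q by (simp add: mult_nonpos_nonneg)
    moreover have "0 \<le> int p * v" using v0 by simp
    ultimately show False using uv by linarith
  qed
  have uv_le: "u \<le> v"
  proof (rule ccontr)
    assume "\<not> u \<le> v"
    then have "(v + 1) * int q \<le> u * int q" using q by (intro mult_right_mono) auto
    moreover have "int p * v \<le> (int q - 1) * v" using pq v0 by (intro mult_right_mono) auto
    ultimately have "v + int q \<le> 1" using uv by (simp add: algebra_simps)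
    then show False using v0 q by linarith
  qed
  have uvF: "of_int u / of_int v \<in> farey n"
    unfolding farey_def using u0 v0 v1 uv_le
    by (intro CollectI exI[of _ "nat u"] exI[of _ "nat v"]) auto
  have rl: "real p / real q < of_int u / of_int v"
  proof -
    have "int p * v < u * int q" using uv by linarith
    then have "real_of_int (int p * v) < real_of_int (u * int q)" by (simp only: of_int_less_iff)
    then show ?thesis using q v0 by (simp add: field_simps)
  qed
  have le: "real p' / real q' \<le> of_int u / of_int v"
    using nob[OF uvF] rl by linarith
  have "real_of_int (int p' * v) \<le> real_of_int (u * int q')"
    using le q v0 by (simp add: field_simps)
  then have le': "int p' * v \<le> u * int q'" by (simp only: of_int_le_iff)
  define d where "d = int p' * int q - int p * int q'"
  define e where "e = u * int q' - int p' * v"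
  have d1: "1 \<le> d" using lt' unfolding d_def by (metis of_nat_less_iff of_nat_mult zle_diff1_eq diff_gt_0_iff_gt int_one_le_iff_zero_less)
  have e0: "0 \<le> e" using le' by (simp add: e_def)
  have key: "int q' = d * v + e * int q"
  proof -
    have "d * v + e * int q = int q' * (u * int q - int p * v)"
      by (simp add: d_def e_def algebra_simps)
    then show ?thesis using uv by simp
  qed
  have "e = 0"
  proof (rule ccontr)
    assume "e \<noteq> 0"
    then have "1 \<le> e" using e0 by linarith
    then have "1 * int q \<le> e * int q" by (intro mult_right_mono) auto
    moreover have "1 * v \<le> d * v" using d1 v0 by (intro mult_right_mono) auto
    ultimately show False using key v2 b2 by linarith
  qed
  then have qd: "int q' = d * v" and "u * int q' = int p' * v"
    using key unfolding e_def by simp_all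
  then have "int p' * v = u * d * v" by auto
  then have pd: "int p' = u * d" using v0 by simp
  have "d dvd int p'" "d dvd int q'" unfolding pd qd by simp_all
  moreover have "coprime (int p') (int q')" using cop by simp
  ultimately have "d dvd 1" by (meson coprime_common_divisor)
  then have "d = 1" using d1 by (simp add: zdvd1_eq)
  then show "int p' * int q - int p * int q' = 1" unfolding d_def .
qed

lemma mediant_of_functional_eq:
  fixes f :: "real \<Rightarrow> real" and p q p' q' :: int
  assumes f0: "f 0 = 0" and f1: "f 1 = 1"
    and E1: "\<And>y. 0 \<le> y \<Longrightarrow> y \<le> 1/2 \<Longrightarrow> f y = f (y / (1 - y)) / 2"
    and E2: "\<And>y. 1/2 \<le> y \<Longrightarrow> y \<le> 1 \<Longrightarrow> f y = (1 + f (2 - 1 / y)) / 2"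
  shows "0 \<le> p \<Longrightarrow> p' \<le> q' \<Longrightarrow> 0 < q \<Longrightarrow> 0 < q' \<Longrightarrow> p' * q - p * q' = 1 \<Longrightarrow>
    f (of_int (p + p') / of_int (q + q')) = (f (of_int p / of_int q) + f (of_int p' / of_int q')) / 2"
proof (induction "nat (q + q')" arbitrary: p q p' q' rule: less_induct)
  case less
  note a = less.prems
  have E1': "f (of_int a / of_int b) = f (of_int a / of_int (b - a)) / 2"
    if "0 \<le> a" "2 * a \<le> b" "0 < b" for a b :: int
  proof -
    have r: "real_of_int (2 * a) \<le> of_int b" using that(2) by (simp only: of_int_le_iff)
    have "real_of_int a / of_int b / (1 - real_of_int a / of_int b) = of_int a / of_int (b - a)"
      using that r by (simp add: field_simps)
    then show ?thesis using E1[of "of_int a / of_int b"] that r by (simp add: field_simps)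
  qed
  have E2': "f (of_int a / of_int b) = (1 + f (of_int (2 * a - b) / of_int a)) / 2"
    if "a \<le> b" "b \<le> 2 * a" "0 < b" for a b :: int
  proof -
    have r: "real_of_int b \<le> of_int (2 * a)" using that(2) by (simp only: of_int_le_iff)
    have "0 < a" using that by linarith
    then have "2 - 1 / (real_of_int a / of_int b) = of_int (2 * a - b) / of_int a"
      using that r by (simp add: field_simps)
    then show ?thesis using E2[of "of_int a / of_int b"] that r by (simp add: field_simps)
  qed
  have p'0: "0 < p'"
  proof (rule ccontr)
    assume "\<not> 0 < p'"
    then have "p' * q \<le> 0" using a by (simp add: mult_nonpos_nonneg)
    moreover have "0 \<le> p * q'" using a by simp
    ultimately show False using a by linarith
  qed
  have pq: "p < q"
  proof (rule ccontr)
    assume "\<not> p < q"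
    then have "q * q' \<le> p * q'" using a by (intro mult_right_mono) auto
    moreover have "p' * q \<le> q' * q" using a by (intro mult_right_mono) auto
    ultimately show False using a(5) by (simp add: algebra_simps)
  qed
  consider (L) "2 * p' \<le> q'" | (R) "q \<le> 2 * p" | (M) "q' < 2 * p'" "2 * p < q" by linarith
  then show ?case
  proof cases
    case L
    have "2 * p' * q \<le> q' * q" using L a by (intro mult_right_mono) auto
    then have "(2 * p) * q' < q * q'" using a(5) by (simp add: algebra_simps)
    then have L2: "2 * p < q" using a by (simp add: mult_less_cancel_right)
    have IH: "f (of_int (p + p') / of_int ((q - p) + (q' - p'))) =
        (f (of_int p / of_int (q - p)) + f (of_int p' / of_int (q' - p'))) / 2"
    proof (rule less.hyps)
      show "nat ((q - p) + (q' - p')) < nat (q + q')" using a p'0 pq L by linarith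
      show "p' * (q - p) - p * (q' - p') = 1" using a by (simp add: algebra_simps)
    qed (use a p'0 pq L in auto)
    have h: "0 \<le> p + p'" "2 * (p + p') \<le> q + q'" "0 < q + q'" using a p'0 L L2 by auto
    have dd: "(q + q') - (p + p') = (q - p) + (q' - p')" by simp
    have "f (of_int (p + p') / of_int (q + q')) = f (of_int (p + p') / of_int ((q - p) + (q' - p'))) / 2"
      using E1'[OF h] unfolding dd .
    moreover have "f (of_int p / of_int q) = f (of_int p / of_int (q - p)) / 2"
      using E1'[of p q] a L2 by simp
    moreover have "f (of_int p' / of_int q') = f (of_int p' / of_int (q' - p')) / 2"
      using E1'[of p' q'] a L p'0 by simp
    ultimately show ?thesis using IH by simp
  next
    case R
    have "q * q' \<le> 2 * p * q'" using R a by (intro mult_right_mono) auto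
    then have "q' * q < (2 * p') * q" using a(5) by (simp add: algebra_simps)
    then have R2: "q' < 2 * p'" using a by (simp add: mult_less_cancel_right)
    have IH: "f (of_int ((2 * p - q) + (2 * p' - q')) / of_int (p + p')) =
        (f (of_int (2 * p - q) / of_int p) + f (of_int (2 * p' - q') / of_int p')) / 2"
    proof (rule less.hyps)
      show "nat (p + p') < nat (q + q')" using a p'0 pq R by linarith
      show "(2 * p' - q') * p - (2 * p - q) * p' = 1" using a by (simp add: algebra_simps)
    qed (use a p'0 pq R R2 in auto)
    have h: "p + p' \<le> q + q'" "q + q' \<le> 2 * (p + p')" "0 < q + q'" using a pq R R2 by auto
    have dd: "2 * (p + p') - (q + q') = (2 * p - q) + (2 * p' - q')" by simp
    have "f (of_int (p + p') / of_int (q + q')) =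
        (1 + f (of_int ((2 * p - q) + (2 * p' - q')) / of_int (p + p'))) / 2"
      using E2'[OF h] unfolding dd .
    moreover have "f (of_int p / of_int q) = (1 + f (of_int (2 * p - q) / of_int p)) / 2"
      using E2'[of p q] a R pq by simp
    moreover have "f (of_int p' / of_int q') = (1 + f (of_int (2 * p' - q') / of_int p')) / 2"
      using E2'[of p' q'] a R2 by simp
    ultimately show ?thesis using IH by simp
  next
    case M
    define i where "i = q - 2 * p"
    define j where "j = 2 * p' - q'"
    have ij: "1 \<le> i" "1 \<le> j" using M by (auto simp: i_def j_def)
    have "p' * i + p * j = 1" using a(5) by (simp add: i_def j_def algebra_simps)
    moreover have "p' * 1 \<le> p' * i" using ij p'0 by (intro mult_left_mono) auto
    moreover have "p * 1 \<le> p * j" using ij a by (intro mult_left_mono) auto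
    ultimately have "p' = 1 \<and> p = 0 \<and> p' * i = 1" using p'0 a(1) by linarith
    then have s: "p' = 1" "p = 0" "p' * i = 1" by auto
    then have "q = 1" "q' = 1" using ij a by (auto simp: i_def j_def)
    then show ?thesis using s f0 f1 E1[of "1/2"] by simp
  qed
qed

definition qm_step :: "(real \<Rightarrow> real) \<Rightarrow> real \<Rightarrow> real" where
  "qm_step f y = (if y \<le> 1/2 then f (y / (1 - y)) / 2 else (1 + f (2 - 1 / y)) / 2)"

lemma qm_step_props:
  assumes "continuous_on {0..1} f" "mono_on {0..1} f" "f 0 = 0" "f 1 = 1"
  shows "continuous_on {0..1} (qm_step f)" "mono_on {0..1} (qm_step f)"
    "qm_step f 0 = 0" "qm_step f 1 = 1"
proof -
  have r1: "y / (1 - y) \<in> {0..1}" if "0 \<le> y" "y \<le> 1/2" for y :: real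
    using that by (auto simp: field_simps)
  have r2: "2 - 1 / y \<in> {0..1}" if "1/2 \<le> y" "y \<le> 1" for y :: real
    using that by (auto simp: field_simps)
  have c1: "continuous_on {0..1/2} (\<lambda>y. f (y / (1 - y)) / 2)"
    by (intro continuous_intros continuous_on_compose2[OF assms(1)]) (use r1 in auto)
  have c2: "continuous_on {1/2..1} (\<lambda>y. (1 + f (2 - 1 / y)) / 2)"
    by (intro continuous_intros continuous_on_compose2[OF assms(1)]) (use r2 in auto)
  have U: "{0..1} = {0..1/2} \<union> {1/2..1::real}" by auto
  show "continuous_on {0..1} (qm_step f)"
    unfolding qm_step_def U
  proof (rule continuous_on_cases[OF _ _ c1 c2])
    show "\<forall>x. x \<in> {0..1/2} \<and> \<not> x \<le> 1/2 \<or> x \<in> {1/2..1} \<and> x \<le> 1/2 \<longrightarrow>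
        f (x / (1 - x)) / 2 = (1 + f (2 - 1 / x)) / 2"
    proof (intro allI impI)
      fix x :: real
      assume "x \<in> {0..1/2} \<and> \<not> x \<le> 1/2 \<or> x \<in> {1/2..1} \<and> x \<le> 1/2"
      then have "x = 1/2" by auto
      then show "f (x / (1 - x)) / 2 = (1 + f (2 - 1 / x)) / 2" using assms by (simp only:) simp
    qed
  qed auto
  show "qm_step f 0 = 0" "qm_step f 1 = 1" using assms by (auto simp: qm_step_def)
  show "mono_on {0..1} (qm_step f)"
  proof (rule mono_onI)
    fix x y :: real
    assume xy: "x \<in> {0..1}" "y \<in> {0..1}" "x \<le> y"
    consider "y \<le> 1/2" | "x \<le> 1/2" "1/2 < y" | "1/2 < x" by linarith
    then show "qm_step f x \<le> qm_step f y"
    proof cases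
      case 1
      have "x / (1 - x) \<le> y / (1 - y)" using xy 1 by (simp add: field_simps)
      then have "f (x / (1 - x)) \<le> f (y / (1 - y))"
        using r1[of x] r1[of y] xy 1 by (intro mono_onD[OF assms(2)]) auto
      then show ?thesis using xy 1 by (simp add: qm_step_def)
    next
      case 2
      have "f (x / (1 - x)) \<le> f 1"
        using r1[of x] xy 2 by (intro mono_onD[OF assms(2)]) auto
      moreover have "f 0 \<le> f (2 - 1 / y)"
        using r2[of y] xy 2 by (intro mono_onD[OF assms(2)]) auto
      ultimately show ?thesis using 2 assms by (simp add: qm_step_def)
    next
      case 3
      have "2 - 1 / x \<le> 2 - 1 / y" using xy 3 by (simp add: field_simps)
      then have "f (2 - 1 / x) \<le> f (2 - 1 / y)"
        using r2[of x] r2[of y] xy 3 by (intro mono_onD[OF assms(2)]) auto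
      then show ?thesis using xy 3 by (simp add: qm_step_def)
    qed
  qed
qed

lemma ex_question_mark: "\<exists>f. is_question_mark f"
proof -
  define g where "g n = (qm_step ^^ n) (\<lambda>y. y)" for n
  have gS: "g (Suc n) = qm_step (g n)" for n by (simp add: g_def)
  have gp: "continuous_on {0..1} (g n) \<and> mono_on {0..1} (g n) \<and> g n 0 = 0 \<and> g n 1 = 1" for n
  proof (induction n)
    case 0
    show ?case by (auto simp: g_def mono_on_def)
  next
    case (Suc n)
    then show ?case unfolding gS using qm_step_props[of "g n"] by blast
  qed
  have g01: "0 \<le> g n y \<and> g n y \<le> 1" if "y \<in> {0..1}" for n y
    using mono_onD[of "{0..1}" "g n" 0 y] mono_onD[of "{0..1}" "g n" y 1] gp[of n] that by auto
  have diff: "\<bar>g (Suc n) y - g n y\<bar> \<le> (1/2) ^ n" if "y \<in> {0..1}" for n y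
    using that
  proof (induction n arbitrary: y)
    case 0
    then show ?case using g01[OF 0, of 0] g01[OF 0, of "Suc 0"] unfolding power_0 abs_le_iff by linarith
  next
    case (Suc n)
    show ?case
    proof (cases "y \<le> 1/2")
      case True
      then have "y / (1 - y) \<in> {0..1}" using Suc by (auto simp: field_simps)
      from Suc.IH[OF this] show ?thesis
        unfolding gS[of "Suc n"] gS[of n] qm_step_def[of _ y] using True
        by (simp add: gS qm_step_def[of "g n" y] abs_if split: if_splits)
    next
      case False
      then have "2 - 1 / y \<in> {0..1}" using Suc by (auto simp: field_simps)
      from Suc.IH[OF this] show ?thesis
        unfolding gS[of "Suc n"] gS[of n] qm_step_def[of _ y] using False
        by (simp add: gS qm_step_def[of "g n" y] add_divide_distrib abs_if split: if_splits)
    qed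
  qed
  define f where "f y = y + (\<Sum>k. g (Suc k) y - g k y)" for y
  have ul0: "uniform_limit {0..1} (\<lambda>n y. \<Sum>k<n. g (Suc k) y - g k y)
      (\<lambda>y. \<Sum>k. g (Suc k) y - g k y) sequentially"
    by (rule Weierstrass_m_test[where M = "\<lambda>n. (1/2) ^ n"]) (use diff in \<open>auto simp: summable_geometric\<close>)
  have tel: "y + (\<Sum>k<n. g (Suc k) y - g k y) = g n y" for n y
    by (subst sum_lessThan_telescope) (simp add: g_def)
  have "uniform_limit {0..1} (\<lambda>n y. y + (\<Sum>k<n. g (Suc k) y - g k y)) f sequentially"
    unfolding f_def by (intro uniform_limit_add uniform_limit_const ul0)
  then have ul: "uniform_limit {0..1} g f sequentially" unfolding tel .
  have lim: "(\<lambda>n. g n y) \<longlonglongrightarrow> f y" if "y \<in> {0..1}" for y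
    using tendsto_uniform_limitI[OF ul that] .
  have cont: "continuous_on {0..1} f"
    by (rule uniform_limit_theorem[OF _ ul]) (use gp in auto)
  have mono: "mono_on {0..1} f"
  proof (rule mono_onI)
    fix x y :: real
    assume xy: "x \<in> {0..1}" "y \<in> {0..1}" "x \<le> y"
    show "f x \<le> f y"
      by (rule LIMSEQ_le[OF lim[OF xy(1)] lim[OF xy(2)]]) (use gp xy mono_onD in blast)
  qed
  have f0: "f 0 = 0" using LIMSEQ_unique[OF lim[of 0]] gp by simp
  have f1: "f 1 = 1" using LIMSEQ_unique[OF lim[of 1]] gp by simp
  have E1: "f y = f (y / (1 - y)) / 2" if y: "0 \<le> y" "y \<le> 1/2" for y
  proof (rule LIMSEQ_unique)
    have "y / (1 - y) \<in> {0..1}" using y by (auto simp: field_simps)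
    from tendsto_divide[OF lim[OF this] tendsto_const[of 2]]
    have "(\<lambda>n. g n (y / (1 - y)) / 2) \<longlonglongrightarrow> f (y / (1 - y)) / 2" by simp
    then show "(\<lambda>n. g (Suc n) y) \<longlonglongrightarrow> f (y / (1 - y)) / 2"
      using y by (simp add: gS qm_step_def)
    show "(\<lambda>n. g (Suc n) y) \<longlonglongrightarrow> f y" by (rule LIMSEQ_Suc[OF lim]) (use y in auto)
  qed
  have E2: "f y = (1 + f (2 - 1 / y)) / 2" if y: "1/2 \<le> y" "y \<le> 1" for y
  proof (cases "y = 1/2")
    case True
    show ?thesis unfolding True using E1[of "1/2"] f0 f1 by simp
  next
    case False
    show ?thesis
    proof (rule LIMSEQ_unique)
      have "2 - 1 / y \<in> {0..1}" using y by (auto simp: field_simps)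
      from tendsto_divide[OF tendsto_add[OF tendsto_const[of 1] lim[OF this]] tendsto_const[of 2]]
      have "(\<lambda>n. (1 + g n (2 - 1 / y)) / 2) \<longlonglongrightarrow> (1 + f (2 - 1 / y)) / 2" by simp
      then show "(\<lambda>n. g (Suc n) y) \<longlonglongrightarrow> (1 + f (2 - 1 / y)) / 2"
        using y False by (simp add: gS qm_step_def)
      show "(\<lambda>n. g (Suc n) y) \<longlonglongrightarrow> f y" by (rule LIMSEQ_Suc[OF lim]) (use y in auto)
    qed
  qed
  have med: "f (real (p + p') / real (q + q')) = (f (real p / real q) + f (real p' / real q')) / 2"
    if c: "consecutive_farey p q p' q'" for p q p' q'
    using mediant_of_functional_eq[of f "int p" "int p'" "int q'" "int q", OF f0 f1 E1 E2]
      farey_det[OF c] c unfolding consecutive_farey_def by simp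
  show ?thesis unfolding is_question_mark_def using cont mono f0 f1 med by blast
qed

lemma is_question_mark_question_mark: "is_question_mark question_mark"
  unfolding question_mark_def by (rule someI_ex[OF ex_question_mark])


subsection \<open>Uniqueness\<close>

lemma consecutive_fareyI:
  fixes p q p' q' :: nat
  assumes q: "0 < q" "0 < q'" and le: "p' \<le> q'" and det: "p' * q = p * q' + 1"
  shows "consecutive_farey p q p' q'"
proof -
  have pq: "p \<le> q"
  proof (rule ccontr)
    assume "\<not> p \<le> q"
    then have "q * q' \<le> p * q'" by (intro mult_right_mono) auto
    moreover have "p' * q \<le> q' * q" using le by (intro mult_right_mono) auto
    ultimately show False using det mult.commute[of q q'] by linarith
  qed
  have cop: "coprime p q"
  proof (rule coprimeI)
    fix c assume "c dvd p" "c dvd q"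
    then have "c dvd p * q'" "c dvd p * q' + 1" using det by (metis dvd_mult2, metis dvd_mult)
    then show "is_unit c" by (metis dvd_add_right_iff)
  qed
  have cop': "coprime p' q'"
  proof (rule coprimeI)
    fix c assume "c dvd p'" "c dvd q'"
    then have "c dvd p * q'" "c dvd p * q' + 1" using det by (metis dvd_mult, metis dvd_mult2)
    then show "is_unit c" by (metis dvd_add_right_iff)
  qed
  have "p * q' < p' * q" using det by simp
  then have "real (p * q') < real (p' * q)" by (simp only: of_nat_less_iff)
  then have lt: "real p / real q < real p' / real q'" using q by (simp add: field_simps)
  define n where "n = max q q'"
  have F: "real p / real q \<in> farey n" "real p' / real q' \<in> farey n"
    unfolding farey_def n_def using q pq le by (force)+
  have nob: "\<not> (real p / real q < r \<and> r < real p' / real q')" if "r \<in> farey n" for r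
  proof
    assume r: "real p / real q < r \<and> r < real p' / real q'"
    obtain a b where ab: "r = real a / real b" "0 < b" "b \<le> n"
      using \<open>r \<in> farey n\<close> unfolding farey_def by blast
    have "real (p * b) < real (a * q)" "real (a * q') < real (p' * b)"
      using r ab q by (auto simp: field_simps)
    then have "int (p * b) < int (a * q)" "int (a * q') < int (p' * b)" by linarith+
    then have s: "1 \<le> int a * int q - int p * int b" "1 \<le> int p' * int b - int a * int q'" by simp_all
    have "1 * int q' \<le> (int a * int q - int p * int b) * int q'"
      "1 * int q \<le> (int p' * int b - int a * int q') * int q"
      using s by (intro mult_right_mono; simp)+
    moreover have "(int a * int q - int p * int b) * int q' + (int p' * int b - int a * int q') * int q
       = int b * (int p' * int q - int p * int q')" by (simp add: algebra_simps)
    moreover have "int p' * int q - int p * int q' = 1"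
      using arg_cong[OF det, of int] by simp
    ultimately have "int q + int q' \<le> int b" by simp
    then show False using ab q by (simp add: n_def)
  qed
  show ?thesis unfolding consecutive_farey_def using q cop cop' lt F nob by blast
qed

lemma farey_parents:
  fixes a b :: nat
  assumes "coprime a b" "2 \<le> b" "a \<le> b"
  shows "\<exists>p q p' q'. a = p + p' \<and> b = q + q' \<and> 0 < q \<and> 0 < q' \<and> p \<le> q \<and> p' \<le> q' \<and>
      p' * q = p * q' + 1"
proof -
  have ab: "a < b" "0 < a" using assms by (cases "a = b"; cases "a = 0"; force)+
  obtain u0 v0 :: int where uv0: "u0 * int a - v0 * int b = 1"
  proof -
    obtain s t where "s * int a + t * int b = 1"
      using bezout_int[of "int a" "int b"] assms(1) by (metis coprime_iff_gcd_eq_1 coprime_int_iff)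
    then have "s * int a - (- t) * int b = 1" by simp
    then show ?thesis by (rule that)
  qed
  \<comment> \<open>the left parent is v/u\<close>
  define u where "u = u0 mod int b"
  define v where "v = v0 - (u0 div int b) * int a"
  have u: "0 \<le> u" "u < int b" using ab by (auto simp: u_def)
  have "u0 = (u0 div int b) * int b + u" by (simp add: u_def)
  then have "u0 * int a = (u0 div int b) * int b * int a + u * int a" by (metis distrib_right)
  then have uv: "u * int a - v * int b = 1" using uv0 by (simp add: v_def algebra_simps)
  have "u \<noteq> 0"
  proof
    assume "u = 0"
    then have "(- v) * int b = 1" using uv by simp
    then have "int b dvd 1" by (metis dvd_triv_right)
    then show False using assms by simp
  qed
  then have u1: "1 \<le> u" using u by linarith
  have v0: "0 \<le> v"
  proof (rule ccontr)
    assume "\<not> 0 \<le> v"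
    then have "v * int b \<le> (- 1) * int b" by (intro mult_right_mono) auto
    moreover have "0 \<le> u * int a" using u by simp
    ultimately show False using uv assms by linarith
  qed
  have vu: "v \<le> u"
  proof (rule ccontr)
    assume "\<not> v \<le> u"
    then have "u * int b \<le> v * int b" by (intro mult_right_mono) auto
    moreover have "u * int a \<le> u * int b" using ab u by (intro mult_left_mono) auto
    ultimately show False using uv by linarith
  qed
  have va: "v \<le> int a"
  proof (rule ccontr)
    assume "\<not> v \<le> int a"
    then have "int a * int b \<le> v * int b" by (intro mult_right_mono) auto
    moreover have "u * int a \<le> int b * int a" using u by (intro mult_right_mono) auto
    ultimately show False using uv by (simp add: mult.commute)
  qed
  have w: "int a - v \<le> int b - u"
  proof (rule ccontr)
    assume "\<not> int a - v \<le> int b - u"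
    then have c: "int b - u + 1 \<le> int a - v" by linarith
    have "(int b - u + 1) * int b \<le> (int a - v) * int b" using c by (intro mult_right_mono) auto
    moreover have "(int b - u) * int a \<le> (int b - u) * int b" using ab u by (intro mult_left_mono) auto
    ultimately have "int b \<le> 1" using uv by (simp add: algebra_simps)
    then show False using assms by linarith
  qed
  have d: "(int a - v) * u = v * (int b - u) + 1" using uv by (simp add: algebra_simps)
  have "int (nat (int a - v) * nat u) = int (nat v * nat (int b - u) + 1)"
    using d va u1 v0 u by simp
  then have d': "nat (int a - v) * nat u = nat v * nat (int b - u) + 1" by (simp only: of_nat_eq_iff)
  show ?thesis
    by (rule exI[of _ "nat v"], rule exI[of _ "nat u"], rule exI[of _ "nat (int a - v)"],
        rule exI[of _ "nat (int b - u)"])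
      (use d' va u1 v0 u vu w in \<open>auto simp: nat_le_iff\<close>)
qed

lemma is_question_mark_eq_rational:
  assumes f: "is_question_mark f" and g: "is_question_mark g"
  shows "coprime a b \<Longrightarrow> 0 < b \<Longrightarrow> a \<le> b \<Longrightarrow> f (real a / real b) = g (real a / real b)"
proof (induction b arbitrary: a rule: less_induct)
  case (less b)
  show ?case
  proof (cases "b = 1")
    case True
    then have "a = 0 \<or> a = 1" using less by auto
    then show ?thesis using f g True by (auto simp: is_question_mark_def)
  next
    case False
    then have "2 \<le> b" using less by linarith
    from farey_parents[OF less.prems(1) this less.prems(3)]
    obtain p q p' q' where h: "a = p + p'" "b = q + q'" "0 < q" "0 < q'" "p \<le> q" "p' \<le> q'"
      "p' * q = p * q' + 1" by blast
    have c: "consecutive_farey p q p' q'" using h by (intro consecutive_fareyI) auto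
    have "f (real p / real q) = g (real p / real q)" "f (real p' / real q') = g (real p' / real q')"
      using c h by (auto intro!: less.IH simp: consecutive_farey_def)
    then show ?thesis using f g c unfolding is_question_mark_def h(1,2) by metis
  qed
qed

lemma question_mark_unique:
  assumes f: "is_question_mark f" and x: "x \<in> {0..1}"
  shows "f x = question_mark x"
proof -
  let ?g = question_mark
  have g: "is_question_mark ?g" by (rule is_question_mark_question_mark)
  let ?S = "{0<..<1} \<inter> \<rat> :: real set"
  have cl: "{0..1} \<subseteq> closure ?S"
  proof -
    have "closure (\<rat> :: real set) = UNIV"
    proof -
      have "\<exists>r\<in>\<rat>. dist r y < e" if "0 < e" for y e :: real
      proof -
        obtain r where "r \<in> \<rat>" "y < r" "r < y + e" using Rats_dense_in_real[of y "y + e"] \<open>0 < e\<close> by auto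
        then show ?thesis by (intro bexI[of _ r]) (auto simp: dist_real_def)
      qed
      then show ?thesis by (auto simp: closure_approachable)
    qed
    then have "closure ?S = closure {0<..<1::real}"
      by (intro closure_open_Int_superset) auto
    then show ?thesis by simp
  qed
  have eq: "f r = ?g r" if "r \<in> ?S" for r
  proof -
    have "r \<in> \<rat>" using that by simp
    then obtain a b :: nat where ab: "b \<noteq> 0" "\<bar>r\<bar> = real a / real b" "coprime a b"
      by (rule Rats_abs_nat_div_natE)
    have r: "r = real a / real b" "r < 1" using ab(2) that by auto
    have "real a / real b < 1" using r by simp
    then have "real a < real b" using ab(1) by (simp add: divide_less_eq_1)
    then have "a \<le> b" by simp
    then show ?thesis using is_question_mark_eq_rational[OF f g ab(3)] ab(1) unfolding r(1) by simp
  qed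
  have cont: "continuous_on {0..1} (\<lambda>y. f y - ?g y)"
    using f g unfolding is_question_mark_def by (intro continuous_on_diff) auto
  have "closure ?S \<subseteq> {0..1}" by (rule closure_minimal) auto
  then have e: "closure ?S = {0..1}" using cl by blast
  have "(\<lambda>y. f y - ?g y) x = 0"
  proof (rule continuous_constant_on_closure[where S = ?S and f = "\<lambda>y. f y - ?g y"])
    show "continuous_on (closure ?S) (\<lambda>y. f y - ?g y)" unfolding e by (rule cont)
    show "f r - ?g r = 0" if "r \<in> ?S" for r using eq[OF that] by simp
    show "x \<in> closure ?S" unfolding e by (rule x)
  qed
  then show ?thesis by simp
qed

end

theory Submission
  imports Defs "HOL-Real_Asymp.Real_Asymp"
begin

text \<open>
  Write q_t for the convergent denominators of x and S_t for the sum of its first t partial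
  quotients. The question mark function changes by exactly 2^(1 - S_t - b) between the convergent
  p_t/q_t and the b-th semiconvergent after it, and every point near x is separated from x by the
  mediant of such an interval around x; hence ?'(x) = 0 iff q_t^2 / 2^(S_t) tends to 0.

  With W_t = q_t + q_(t-1) / lambda1, a partial quotient a multiplies W by lambda1 times a factor
  between 1 + (a-1) / lambda1^2 and 1 + (a-1) / lambda1. So ?'(x) = 0 forces
  D_t = S_t - kappa1 t to exceed (2 / ln 2) times the sum of ln (1 + (a_i - 1) / lambda1^2).
  If D is at most M up to time t, all a_i are at most M + O(1), and concavity of the logarithm bounds
  this sum below by (kappa1 - 1) t ln M / M up to lower order, so M^2 is at least
  (2 / ln 2) (kappa1 - 1) t ln M. As ln M exceeds (ln t) / 2, this gives (i). For (ii), let all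
  partial quotients be 1 except for the j-th peak, at time about j^2 ln j / (2 ln lambda1 - ln 2),
  which is just large enough to compensate the loss until the next peak together with the
  logarithmic cost of the peaks.
\<close>


subsection \<open>Slopes of the question mark function on Farey intervals\<close>

text \<open>Unimodular pairs in [0,1], in either order: convergents lie on alternating sides of x,
  so a symmetric relation saves a case split on parity.\<close>

definition farey_neighbours :: "nat \<Rightarrow> nat \<Rightarrow> nat \<Rightarrow> nat \<Rightarrow> bool" where
  "farey_neighbours p q p' q' \<longleftrightarrow> 0 < q \<and> 0 < q' \<and> p \<le> q \<and> p' \<le> q' \<and>
     (p' * q = p * q' + 1 \<or> p * q' = p' * q + 1)"

lemma farey_neighbours_commute: "farey_neighbours p q p' q' \<Longrightarrow> farey_neighbours p' q' p q"
  by (auto simp: farey_neighbours_def)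

lemma farey_neighbours_mediant: "farey_neighbours p q p' q' \<Longrightarrow> farey_neighbours p q (k * p + p') (k * q + q')"
proof -
  assume "farey_neighbours p q p' q'"
  moreover from this have "k * p \<le> k * q" by (auto simp: farey_neighbours_def)
  ultimately show ?thesis by (auto simp: farey_neighbours_def algebra_simps intro: add_mono)
qed

lemma farey_neighbours_dist:
  assumes "farey_neighbours p q p' q'"
  shows "\<bar>real p' / real q' - real p / real q\<bar> = 1 / (real q * real q')"
proof -
  have q: "real q > 0" "real q' > 0" using assms by (auto simp: farey_neighbours_def)
  have "real p' * real q = real p * real q' + 1 \<or> real p * real q' = real p' * real q + 1"
    using assms unfolding farey_neighbours_def by (metis of_nat_1 of_nat_add of_nat_mult)
  then have "\<bar>real p' * real q - real p * real q'\<bar> = 1" by auto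
  moreover have "real p' / real q' - real p / real q = (real p' * real q - real p * real q') / (real q * real q')"
    using q by (simp add: field_simps)
  ultimately show ?thesis using q by (simp add: abs_mult)
qed

lemma farey_neighbours_Icc:
  assumes "farey_neighbours p q p' q'"
  shows "real p / real q \<in> {0..1}" "real p' / real q' \<in> {0..1}"
  using assms by (auto simp: farey_neighbours_def)

lemma question_mark_mediant:
  assumes "farey_neighbours p q p' q'"
  shows "question_mark (real (p + p') / real (q + q')) =
    (question_mark (real p / real q) + question_mark (real p' / real q')) / 2"
proof -
  note qm = is_question_mark_question_mark[unfolded is_question_mark_def]
  have "consecutive_farey p q p' q' \<or> consecutive_farey p' q' p q"
    using assms by (auto simp: farey_neighbours_def intro: consecutive_fareyI)
  then show ?thesis
    using qm by (metis add.commute)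
qed

lemma question_mark_mono: "0 \<le> y \<Longrightarrow> y \<le> z \<Longrightarrow> z \<le> 1 \<Longrightarrow> question_mark y \<le> question_mark z"
  using is_question_mark_question_mark unfolding is_question_mark_def
  by (auto elim!: mono_onD)

text \<open>Each mediant with the fixed end \<open>p / q\<close> halves the increment measured from
  that end.\<close>

lemma question_mark_iterated_mediant:
  assumes "farey_neighbours p q p' q'"
  shows "question_mark (real (k * p + p') / real (k * q + q')) - question_mark (real p / real q) =
    (question_mark (real p' / real q') - question_mark (real p / real q)) / 2 ^ k"
proof (induction k)
  case (Suc k)
  have "question_mark (real (p + (k * p + p')) / real (q + (k * q + q'))) =
    (question_mark (real p / real q) + question_mark (real (k * p + p') / real (k * q + q'))) / 2"
    by (rule question_mark_mediant[OF farey_neighbours_mediant[OF assms]])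
  moreover have "p + (k * p + p') = Suc k * p + p'" "q + (k * q + q') = Suc k * q + q'" by simp_all
  ultimately have "question_mark (real (Suc k * p + p') / real (Suc k * q + q')) - question_mark (real p / real q) =
    (question_mark (real (k * p + p') / real (k * q + q')) - question_mark (real p / real q)) / 2"
    by (simp add: field_simps)
  then show ?case unfolding Suc by simp
qed simp

lemma question_mark_segment_mono:
  assumes "c \<in> {0..1}" "e \<in> {0..1}" "y \<in> closed_segment c e"
  shows "\<bar>question_mark y - question_mark c\<bar> \<le> \<bar>question_mark e - question_mark c\<bar>"
proof (cases "c \<le> e")
  case True
  then have "c \<le> y" "y \<le> e" using assms by (auto simp: closed_segment_eq_real_ivl)
  then show ?thesis using question_mark_mono[of c y] question_mark_mono[of y e] assms by auto
next
  case False
  then have "e \<le> y" "y \<le> c" using assms by (auto simp: closed_segment_eq_real_ivl)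
  then show ?thesis using question_mark_mono[of y c] question_mark_mono[of e y] assms by auto
qed

lemma closed_segment_sub:
  fixes c e y e' :: real
  assumes "y \<in> closed_segment c e" "e' \<in> closed_segment c e" "\<bar>y - c\<bar> \<le> \<bar>e' - c\<bar>"
  shows "y \<in> closed_segment c e'"
  using assms by (auto simp: closed_segment_eq_real_ivl split: if_splits)

lemma mediant_in_segment:
  assumes "farey_neighbours p q p' q'"
  shows "real (k * p + p') / real (k * q + q') \<in> closed_segment (real p / real q) (real p' / real q')"
proof -
  have q: "real q > 0" "real q' > 0" using assms by (auto simp: farey_neighbours_def)
  have kq: "real k * real q + real q' > 0" using q by (simp add: add_nonneg_pos)
  \<comment> \<open>Weights proportional to the denominators \<open>k * q\<close> and
    \<open>q'\<close> exhibit the mediant as a convex combination.\<close>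
  define u where "u = real q' / (real k * real q + real q')"
  have "real (k * p + p') / real (k * q + q') = (1 - u) *\<^sub>R (real p / real q) + u *\<^sub>R (real p' / real q')"
    using q kq by (simp add: u_def divide_simps)
  moreover have "0 \<le> u" "u \<le> 1" using q kq by (auto simp: u_def divide_simps)
  ultimately show ?thesis unfolding closed_segment_def by blast
qed

text \<open>The mediants \<open>(k * p + p') / (k * q + q')\<close> tend to \<open>p / q\<close>.
  For y between the k-th and the next one, the increment is at most its k-fold halving, while the
  distance exceeds \<open>1 / (q * ((k + 1) * q + q'))\<close>. Since
  \<open>k + 1 \<le> 2 ^ k\<close>, the resulting slope bound is largest for k = 0.\<close>

lemma question_mark_slope_at_endpoint:
  assumes fn: "farey_neighbours p q p' q'"
    and y: "y \<in> closed_segment (real p / real q) (real p' / real q')"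
  shows "\<bar>question_mark y - question_mark (real p / real q)\<bar> \<le>
    \<bar>question_mark (real p' / real q') - question_mark (real p / real q)\<bar> * (real q * (real q + real q')) *
    \<bar>y - real p / real q\<bar>"
proof (cases "y = real p / real q")
  case False
  let ?c = "real p / real q" and ?e = "real p' / real q'"
  let ?g = "\<bar>question_mark ?e - question_mark ?c\<bar>"
  have q: "real q > 0" "real q' > 0" using fn by (auto simp: farey_neighbours_def)
  define d where "d = \<bar>y - ?c\<bar>"
  have d: "d > 0" using False by (simp add: d_def)
  have "d \<le> \<bar>?e - ?c\<bar>" using y by (auto simp: d_def closed_segment_eq_real_ivl split: if_splits)
  then have "d \<le> 1 / (real q * real q')" using farey_neighbours_dist[OF fn] by simp
  then have dq: "real q' \<le> 1 / (real q * d)" using q d by (simp add: field_simps)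
  \<comment> \<open>The last mediant whose distance \<open>1 / (q * (k * q + q'))\<close> from
    \<open>p / q\<close> is still at least \<open>d\<close>.\<close>
  define k where "k = nat \<lfloor>(1 / (real q * d) - real q') / real q\<rfloor>"
  have "0 \<le> (1 / (real q * d) - real q') / real q" using dq q by simp
  then have "real k \<le> (1 / (real q * d) - real q') / real q" "(1 / (real q * d) - real q') / real q < real k + 1"
    unfolding k_def by linarith+
  then have k: "real k * real q + real q' \<le> 1 / (real q * d)" "1 / (real q * d) < (real k + 1) * real q + real q'"
    using q by (simp_all add: pos_le_divide_eq pos_divide_less_eq algebra_simps)
  let ?m = "real (k * p + p') / real (k * q + q')"
  have kq: "real k * real q + real q' > 0" using q by (simp add: add_nonneg_pos)
  have m: "\<bar>?m - ?c\<bar> = 1 / (real q * (real k * real q + real q'))"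
    using farey_neighbours_dist[OF farey_neighbours_mediant[OF fn, of k]] by simp
  have "d \<le> \<bar>?m - ?c\<bar>" unfolding m using k(1) q d kq
    by (simp add: pos_le_divide_eq mult.commute mult.left_commute)
  then have "y \<in> closed_segment ?c ?m"
    by (intro closed_segment_sub[OF y mediant_in_segment[OF fn]]) (simp add: d_def)
  then have "\<bar>question_mark y - question_mark ?c\<bar> \<le> \<bar>question_mark ?m - question_mark ?c\<bar>"
    by (rule question_mark_segment_mono[OF farey_neighbours_Icc[OF farey_neighbours_mediant[OF fn]]])
  also have "\<dots> = ?g / 2 ^ k"
    unfolding question_mark_iterated_mediant[OF fn] by simp
  also have "\<dots> \<le> ?g * (real q * (real q + real q')) * d"
  proof -
    have "1 < ((real k + 1) * real q + real q') * (real q * d)"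
      using k(2) q d by (simp add: pos_divide_less_eq)
    also have "\<dots> \<le> ((real k + 1) * (real q + real q')) * (real q * d)"
      using q d by (intro mult_right_mono) (auto simp: algebra_simps)
    also have "\<dots> \<le> (2 ^ k * (real q + real q')) * (real q * d)"
    proof -
      have "Suc k \<le> 2 ^ k" by (simp add: Suc_leI less_exp)
      then have "real (Suc k) \<le> 2 ^ k" by (metis of_nat_le_iff of_nat_numeral of_nat_power)
      then show ?thesis using q d by (intro mult_right_mono) auto
    qed
    finally have "1 / 2 ^ k \<le> (real q * (real q + real q')) * d" by (simp add: field_simps)
    then have "?g * (1 / 2 ^ k) \<le> ?g * ((real q * (real q + real q')) * d)" by (intro mult_left_mono) auto
    then show ?thesis by (simp add: mult.assoc)
  qed
  finally show ?thesis by (simp add: d_def)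
qed simp

text \<open>The endpoint bound is applied at m on both sides. Each side carries half of the
  increment, and its denominators contribute at most \<open>(q + q') * (2 * (q + q'))\<close>. As m
  lies between x and y, the two distances add up.\<close>

lemma question_mark_slope_across_mediant:
  assumes fn: "farey_neighbours p q p' q'"
    and m: "m = real (p + p') / real (q + q')"
    and x: "x \<in> closed_segment (real p / real q) m"
    and y: "y \<in> closed_segment m (real p' / real q')"
  shows "\<bar>question_mark x - question_mark y\<bar> \<le>
    \<bar>question_mark (real p' / real q') - question_mark (real p / real q)\<bar> * (real q + real q')\<^sup>2 * \<bar>x - y\<bar>"
proof -
  let ?f = question_mark
  let ?c = "real p / real q" and ?e = "real p' / real q'" and ?Q = "real (q + q')"
  let ?g = "\<bar>?f ?e - ?f ?c\<bar>"
  have q: "real q > 0" "real q' > 0" using fn by (auto simp: farey_neighbours_def)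
  have fm: "?f m = (?f ?c + ?f ?e) / 2" unfolding m by (rule question_mark_mediant[OF fn])
  have nb1: "farey_neighbours (p + p') (q + q') p q"
    using farey_neighbours_commute[OF farey_neighbours_mediant[OF fn, of 1]] by simp
  have nb2: "farey_neighbours (p + p') (q + q') p' q'"
    using farey_neighbours_commute[OF farey_neighbours_mediant[OF farey_neighbours_commute[OF fn], of 1]] by (simp add: add.commute)
  have half: "(g / 2) * (Q * (2 * Q)) = g * Q\<^sup>2" for g Q :: real by (simp add: power2_eq_square)
  have "\<bar>?f x - ?f m\<bar> \<le> \<bar>?f ?c - ?f m\<bar> * (?Q * (?Q + real q)) * \<bar>x - m\<bar>"
    using question_mark_slope_at_endpoint[OF nb1, folded m] x by (simp add: closed_segment_commute)
  also have "\<dots> \<le> (?g / 2) * (?Q * (2 * ?Q)) * \<bar>x - m\<bar>"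
    using q by (intro mult_right_mono mult_mono) (auto simp: fm abs_minus_commute field_simps)
  finally have 1: "\<bar>?f x - ?f m\<bar> \<le> ?g * ?Q\<^sup>2 * \<bar>x - m\<bar>" unfolding half .
  have "\<bar>?f y - ?f m\<bar> \<le> \<bar>?f ?e - ?f m\<bar> * (?Q * (?Q + real q')) * \<bar>y - m\<bar>"
    using question_mark_slope_at_endpoint[OF nb2, folded m] y by simp
  also have "\<dots> \<le> (?g / 2) * (?Q * (2 * ?Q)) * \<bar>y - m\<bar>"
    using q by (intro mult_right_mono mult_mono) (auto simp: fm abs_minus_commute field_simps)
  finally have 2: "\<bar>?f y - ?f m\<bar> \<le> ?g * ?Q\<^sup>2 * \<bar>y - m\<bar>" unfolding half .
  have "m \<in> closed_segment ?c ?e" unfolding m using mediant_in_segment[OF fn, of 1] by simp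
  then have "\<bar>x - m\<bar> + \<bar>y - m\<bar> = \<bar>x - y\<bar>"
    using x y by (auto simp: closed_segment_eq_real_ivl split: if_splits)
  then have "?g * ?Q\<^sup>2 * \<bar>x - y\<bar> = ?g * ?Q\<^sup>2 * \<bar>x - m\<bar> + ?g * ?Q\<^sup>2 * \<bar>y - m\<bar>"
    by (metis distrib_left)
  moreover have "\<bar>?f x - ?f y\<bar> \<le> \<bar>?f x - ?f m\<bar> + \<bar>?f y - ?f m\<bar>" by linarith
  ultimately have "\<bar>?f x - ?f y\<bar> \<le> ?g * ?Q\<^sup>2 * \<bar>x - y\<bar>" using 1 2 by linarith
  then show ?thesis by simp
qed


subsection \<open>Convergents and growth of their denominators\<close>

text \<open>The indices are shifted: at n these are the numerator and denominator of the convergent n - 1,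
  starting with 1/0.\<close>

fun cnum :: "(nat \<Rightarrow> nat) \<Rightarrow> nat \<Rightarrow> nat" where
  "cnum a 0 = 1"
| "cnum a (Suc 0) = 0"
| "cnum a (Suc (Suc n)) = a (Suc n) * cnum a (Suc n) + cnum a n"

fun cden :: "(nat \<Rightarrow> nat) \<Rightarrow> nat \<Rightarrow> nat" where
  "cden a 0 = 0"
| "cden a (Suc 0) = 1"
| "cden a (Suc (Suc n)) = a (Suc n) * cden a (Suc n) + cden a n"

locale cf_word =
  fixes a :: "nat \<Rightarrow> nat"
  assumes a_pos: "1 \<le> a (Suc n)"
begin

abbreviation "P \<equiv> cnum a"
abbreviation "Q \<equiv> cden a"

lemma one_le_a: "1 \<le> i \<Longrightarrow> 1 \<le> a i"
  using a_pos[of "i - 1"] by simp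

lemma Q_pos: "0 < Q (Suc n)"
proof (induction n)
  case (Suc n)
  then show ?case using a_pos[of n] by simp
qed simp

lemma Q_step: "Q n + Q (Suc n) \<le> Q (Suc (Suc n))"
proof -
  have "1 * Q (Suc n) \<le> a (Suc n) * Q (Suc n)" using a_pos by (intro mult_right_mono) auto
  then show ?thesis by simp
qed

lemma Q_mono: "Q n \<le> Q (Suc n)"
proof (cases n)
  case (Suc k)
  then show ?thesis using Q_step[of k] by (metis add_leD2)
qed simp

lemma Q_ge: "n \<le> Q (Suc n)"
proof (induction n)
  case (Suc n)
  show ?case
  proof (cases n)
    case (Suc k)
    then have "0 < Q n" using Q_pos by simp
    then show ?thesis using Q_step[of n] Suc.IH by linarith
  qed (use Q_pos[of 1] in simp)
qed simp

lemma det_cases: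
  "P (Suc n) * Q n + 1 = P n * Q (Suc n) \<or> P (Suc n) * Q n = P n * Q (Suc n) + 1"
proof (induction n)
  case (Suc n)
  then show ?case by (auto simp: algebra_simps)
qed simp

text \<open>Plain \<open>P n \<le> Q n\<close> fails for the formal fraction 1/0 at index 0; the
  bound for the sum of two neighbours holds from the start and carries the induction.\<close>

lemma P_le_Q: "P (Suc n) \<le> Q (Suc n) \<and> P (Suc n) + P n \<le> Q (Suc n) + Q n"
proof (induction n)
  case (Suc n)
  obtain c where c: "a (Suc n) = Suc c" using a_pos[of n] by (cases "a (Suc n)") auto
  have "c * P (Suc n) \<le> c * Q (Suc n)" using Suc by (intro mult_left_mono) auto
  then show ?case using Suc unfolding cnum.simps cden.simps c mult_Suc by linarith
qed simp

lemma farey_neighbours_semiconvergent: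
  assumes "1 \<le> b"
  shows "farey_neighbours (P (Suc n)) (Q (Suc n)) (b * P (Suc n) + P n) (b * Q (Suc n) + Q n)"
proof -
  obtain c where c: "b = Suc c" using assms by (cases b) auto
  have "farey_neighbours (P (Suc n)) (Q (Suc n)) (P (Suc n) + P n) (Q (Suc n) + Q n)"
    using P_le_Q[of n] Q_pos[of n] det_cases[of n] by (auto simp: farey_neighbours_def algebra_simps)
  from farey_neighbours_mediant[OF this, of c] show ?thesis by (simp add: c algebra_simps)
qed

definition convergent :: "nat \<Rightarrow> real" where
  "convergent n = real (P (Suc n)) / real (Q (Suc n))"

definition semiconvergent :: "nat \<Rightarrow> nat \<Rightarrow> real" where
  "semiconvergent n b = real (b * P (Suc n) + P n) / real (b * Q (Suc n) + Q n)"

lemma semiconvergent_last: "semiconvergent n (a (Suc n)) = convergent (Suc n)"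
  by (simp add: semiconvergent_def convergent_def)

text \<open>One step past the last semiconvergent opens the next level: both are the mediant of the
  convergents n and n + 1.\<close>

lemma semiconvergent_next: "semiconvergent n (Suc (a (Suc n))) = semiconvergent (Suc n) 1"
  by (simp add: semiconvergent_def add_ac)

lemma question_mark_semiconvergent_halves:
  "question_mark (semiconvergent n (Suc k)) - question_mark (convergent n) =
    (question_mark (semiconvergent n 1) - question_mark (convergent n)) / 2 ^ k"
  using question_mark_iterated_mediant[OF farey_neighbours_semiconvergent[of 1 n], of k]
  by (simp add: semiconvergent_def convergent_def algebra_simps)

lemma question_mark_gap:
  assumes "1 \<le> b"
  shows "\<bar>question_mark (semiconvergent n b) - question_mark (convergent n)\<bar> = 2 / 2 ^ (sum a {1..n} + b)"
proof -
  have 1: "\<bar>question_mark (semiconvergent n 1) - question_mark (convergent n)\<bar> = 1 / 2 ^ (sum a {1..n})"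
  proof (induction n)
    case 0
    then show ?case
      using is_question_mark_question_mark by (simp add: semiconvergent_def convergent_def is_question_mark_def)
  next
    case (Suc n)
    obtain c where c: "a (Suc n) = Suc c" using a_pos[of n] by (cases "a (Suc n)") auto
    define D where "D = question_mark (semiconvergent n 1) - question_mark (convergent n)"
    \<comment> \<open>Both points are semiconvergents of level n, at \<open>Suc (Suc c)\<close> and
      \<open>Suc c\<close>, so their increments from \<open>convergent n\<close> are known halvings
      of \<open>D\<close>.\<close>
    have "question_mark (semiconvergent (Suc n) 1) - question_mark (convergent (Suc n)) = D / 2 ^ Suc c - D / 2 ^ c"
      unfolding semiconvergent_next[symmetric] semiconvergent_last[symmetric] D_def
        question_mark_semiconvergent_halves[symmetric] by (simp add: c)
    also have "\<dots> = - D / 2 ^ Suc c" by (simp add: field_simps)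
    finally show ?case using Suc unfolding D_def[symmetric]
      by (simp add: abs_divide c power_add)
  qed
  obtain c where c: "b = Suc c" using assms by (cases b) auto
  show ?thesis
    unfolding c question_mark_semiconvergent_halves abs_divide 1 by (simp add: power_add)
qed

lemma semiconvergent_dist:
  "1 \<le> b \<Longrightarrow> \<bar>semiconvergent n b - convergent n\<bar> = 1 / (real (Q (Suc n)) * (real b * real (Q (Suc n)) + real (Q n)))"
  using farey_neighbours_dist[OF farey_neighbours_semiconvergent[of b n]] by (simp add: semiconvergent_def convergent_def)

definition golden_norm :: "nat \<Rightarrow> real" where
  "golden_norm n = real (Q (Suc n)) + real (Q n) / lambda1"

end

section \<open>Growth of the denominators compared with powers of the golden ratio\<close>

lemma lambda1_sq: "lambda1\<^sup>2 = lambda1 + 1"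
  by (simp add: lambda1_def power2_eq_square field_simps)

lemma lambda1_bounds: "1.6 < lambda1" "lambda1 < 1.7"
proof -
  have "2.2 < sqrt (5::real)" by (rule real_less_rsqrt) (simp add: power2_eq_square)
  moreover have "sqrt (5::real) < 2.4" by (rule real_less_lsqrt) (auto simp: power2_eq_square)
  ultimately show "1.6 < lambda1" "lambda1 < 1.7" by (auto simp: lambda1_def)
qed

lemma lambda1_inverse: "1 / lambda1 = lambda1 - 1"
  using lambda1_sq lambda1_bounds by (simp add: field_simps power2_eq_square)

context cf_word
begin

text \<open>The row vector (1, 1/lambda1) is a left eigenvector of the matrix of a partial quotient 1.\<close>

lemma golden_norm_Suc:
  "golden_norm (Suc n) = lambda1 * golden_norm n + (real (a (Suc n)) - 1) * real (Q (Suc n))"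
proof -
  have "golden_norm (Suc n) = real (a (Suc n)) * real (Q (Suc n)) + real (Q n) + real (Q (Suc n)) * (1 / lambda1)"
    by (simp add: golden_norm_def)
  moreover have "lambda1 * golden_norm n = lambda1 * real (Q (Suc n)) + real (Q n)"
    using lambda1_bounds by (simp add: golden_norm_def field_simps)
  ultimately show ?thesis unfolding lambda1_inverse by (simp add: algebra_simps)
qed

lemma Q_le_golden_norm: "real (Q (Suc n)) \<le> golden_norm n"
  using lambda1_bounds by (simp add: golden_norm_def)

lemma golden_norm_le_Q: "golden_norm n \<le> lambda1 * real (Q (Suc n))"
proof -
  have "real (Q n) / lambda1 \<le> real (Q (Suc n)) / lambda1"
    using lambda1_bounds Q_mono[of n] by (intro divide_right_mono) auto
  moreover have "real (Q (Suc n)) / lambda1 = real (Q (Suc n)) * (lambda1 - 1)"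
    using lambda1_inverse by (metis times_divide_eq_right mult.right_neutral)
  ultimately show ?thesis by (simp add: golden_norm_def algebra_simps)
qed

text \<open>The extra term in \<open>golden_norm_Suc\<close> is at most \<open>a (Suc n) - 1\<close>
  times the norm, because the norm dominates the denominator.\<close>

lemma golden_norm_upper:
  "golden_norm n \<le> lambda1 ^ n * (\<Prod>i=1..n. 1 + (real (a i) - 1) / lambda1)"
proof (induction n)
  case 0
  then show ?case by (simp add: golden_norm_def)
next
  case (Suc n)
  have "golden_norm (Suc n) \<le> lambda1 * golden_norm n + (real (a (Suc n)) - 1) * golden_norm n"
    unfolding golden_norm_Suc using Q_le_golden_norm a_pos[of n] by (intro add_left_mono mult_left_mono) auto
  also have "\<dots> = golden_norm n * (lambda1 * (1 + (real (a (Suc n)) - 1) / lambda1))"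
    using lambda1_bounds by (simp add: field_simps)
  also have "\<dots> \<le> lambda1 ^ n * (\<Prod>i=1..n. 1 + (real (a i) - 1) / lambda1) *
      (lambda1 * (1 + (real (a (Suc n)) - 1) / lambda1))"
    using Suc lambda1_bounds a_pos[of n] by (intro mult_right_mono mult_nonneg_nonneg) auto
  finally show ?case by (simp add: mult_ac)
qed

text \<open>Here the denominator is estimated from below by \<open>golden_norm n / lambda1\<close>,
  which costs the second factor \<open>lambda1\<close> in the products.\<close>

lemma golden_norm_lower:
  "lambda1 ^ n * (\<Prod>i=1..n. 1 + (real (a i) - 1) / lambda1\<^sup>2) \<le> golden_norm n"
proof (induction n)
  case 0
  then show ?case by (simp add: golden_norm_def)
next
  case (Suc n)
  have "lambda1 ^ Suc n * (\<Prod>i=1..Suc n. 1 + (real (a i) - 1) / lambda1\<^sup>2) =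
      lambda1 ^ n * (\<Prod>i=1..n. 1 + (real (a i) - 1) / lambda1\<^sup>2) *
      (lambda1 * (1 + (real (a (Suc n)) - 1) / lambda1\<^sup>2))"
    by (simp add: mult_ac)
  also have "\<dots> \<le> golden_norm n * (lambda1 * (1 + (real (a (Suc n)) - 1) / lambda1\<^sup>2))"
    using Suc lambda1_bounds a_pos[of n] by (intro mult_right_mono mult_nonneg_nonneg) auto
  also have "\<dots> = lambda1 * golden_norm n + (real (a (Suc n)) - 1) * (golden_norm n / lambda1)"
    using lambda1_bounds by (simp add: field_simps power2_eq_square)
  also have "\<dots> \<le> golden_norm (Suc n)"
    unfolding golden_norm_Suc using golden_norm_le_Q[of n] a_pos[of n] lambda1_bounds
    by (intro add_left_mono mult_left_mono) (auto simp: field_simps)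
  finally show ?case .
qed

end

text \<open>The number being expanded is \<open>r 0\<close>, and \<open>r n\<close> is its n-th
  tail, an orbit of the Gauss map. Keeping the tails abstract serves both expanding a given x and
  building x from a prescribed word.\<close>

locale cf_expansion = cf_word +
  fixes r :: "nat \<Rightarrow> real"
  assumes r_bounds: "0 < r n" "r n < 1"
    and r_Suc: "r n = 1 / (real (a (Suc n)) + r (Suc n))"
begin

lemma expand: "r 0 = (real (P (Suc n)) + r n * real (P n)) / (real (Q (Suc n)) + r n * real (Q n))"
proof (induction n)
  case (Suc n)
  define s where "s = real (a (Suc n)) + r (Suc n)"
  have s: "s > 0" using r_bounds(1)[of "Suc n"] by (simp add: s_def add_nonneg_pos)
  have rn: "r n = 1 / s" by (simp add: s_def r_Suc[of n])
  have "r 0 = (s * (real (P (Suc n)) + 1 / s * real (P n))) / (s * (real (Q (Suc n)) + 1 / s * real (Q n)))"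
    using Suc s by (simp add: rn)
  also have "\<dots> = (s * real (P (Suc n)) + real (P n)) / (s * real (Q (Suc n)) + real (Q n))"
    using s by (simp add: algebra_simps)
  finally show ?case by (simp add: s_def algebra_simps)
qed simp

text \<open>With \<open>s = 1 / r n\<close>, x is given by the semiconvergent formula at the real
  parameter s, and \<open>b \<le> a (Suc n) < s\<close>. The signed distance from
  \<open>convergent n\<close> at parameter s is \<open>\<sigma> / (q * (s * q + q'))\<close>, of
  constant sign and strictly decreasing in size, so x falls strictly inside.\<close>

lemma x_in_segment:
  assumes "1 \<le> b" "b \<le> a (Suc n)"
  shows "r 0 \<in> closed_segment (convergent n) (semiconvergent n b)" "r 0 \<noteq> convergent n" "r 0 \<noteq> semiconvergent n b"
proof -
  define s where "s = 1 / r n"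
  have s: "s = real (a (Suc n)) + r (Suc n)" by (simp add: s_def r_Suc[of n])
  have sb: "s > real b" using assms r_bounds(1)[of "Suc n"] by (simp add: s)
  define q q' p p' where "q = real (Q (Suc n))" and "q' = real (Q n)"
    and "p = real (P (Suc n))" and "p' = real (P n)"
  have q: "q > 0" "q' \<ge> 0" using Q_pos by (auto simp: q_def q'_def)
  have b: "real b \<ge> 1" using assms by simp
  have pos: "s * q + q' > 0" "real b * q + q' > 0"
    using q sb b by (auto intro!: add_pos_nonneg mult_pos_pos)
  have "r 0 = (p + r n * p') / (q + r n * q')" unfolding p_def q_def p'_def q'_def by (rule expand)
  also have "\<dots> = (s * p + p') / (s * q + q')"
  proof -
    have "q + r n * q' > 0" using q r_bounds[of n] by (intro add_pos_nonneg) auto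
    moreover have "s * (q + r n * q') = s * q + q'" "s * (p + r n * p') = s * p + p'"
      using r_bounds(1)[of n] by (simp_all add: s_def field_simps)
    ultimately show ?thesis using pos(1) sb by (metis mult_divide_mult_cancel_left less_irrefl
      of_nat_0_le_iff order_le_less_trans)
  qed
  finally have x: "r 0 = (s * p + p') / (s * q + q')" .
  have det: "\<bar>p' * q - p * q'\<bar> = 1"
  proof -
    have "p * q' + 1 = p' * q \<or> p * q' = p' * q + 1"
      using det_cases[of n] unfolding p_def q_def p'_def q'_def
      by (metis of_nat_1 of_nat_add of_nat_mult)
    then show ?thesis by auto
  qed
  define \<sigma> where "\<sigma> = p' * q - p * q'"
  have \<sigma>: "\<bar>\<sigma>\<bar> = 1" using det by (simp add: \<sigma>_def)
  have c: "convergent n = p / q" by (simp add: convergent_def p_def q_def)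
  have e: "semiconvergent n b = (real b * p + p') / (real b * q + q')"
    by (simp add: semiconvergent_def p_def q_def p'_def q'_def)
  have xc: "r 0 - convergent n = \<sigma> / (q * (s * q + q'))"
    unfolding x c \<sigma>_def using pos q by (simp add: field_simps)
  have ec: "semiconvergent n b - convergent n = \<sigma> / (q * (real b * q + q'))"
    unfolding e c \<sigma>_def using pos q by (simp add: field_simps)
  have lt: "1 / (q * (s * q + q')) < 1 / (q * (real b * q + q'))"
    using pos q sb by (intro divide_strict_left_mono mult_strict_left_mono) auto
  have pp: "0 < 1 / (q * (s * q + q'))" using pos q by simp
  consider "\<sigma> = 1" | "\<sigma> = -1" using \<sigma> by linarith
  then have "r 0 \<in> closed_segment (convergent n) (semiconvergent n b) \<and> r 0 \<noteq> convergent n \<and> r 0 \<noteq> semiconvergent n b"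
  proof cases
    case 1
    have "convergent n < r 0" "r 0 < semiconvergent n b" using xc ec lt pp unfolding 1 by linarith+
    then show ?thesis by (auto simp: closed_segment_eq_real_ivl)
  next
    case 2
    have m: "(- 1) / u = - (1 / u)" for u :: real by simp
    have "r 0 < convergent n" "semiconvergent n b < r 0" using xc ec lt pp unfolding 2 m by linarith+
    then show ?thesis by (auto simp: closed_segment_eq_real_ivl)
  qed
  then show "r 0 \<in> closed_segment (convergent n) (semiconvergent n b)" "r 0 \<noteq> convergent n" "r 0 \<noteq> semiconvergent n b" by auto
qed

end


subsection \<open>The derivative in terms of the partial quotients\<close>

text \<open>Multiplying out the difference quotient, with a non-strict bound, makes the exclusion of
  \<open>y = x\<close> disappear.\<close>

lemma has_real_derivative_zero_iff:
  fixes f :: "real \<Rightarrow> real"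
  shows "(f has_real_derivative 0) (at x) \<longleftrightarrow>
    (\<forall>\<epsilon>>0. \<exists>\<delta>>0. \<forall>y. \<bar>y - x\<bar> < \<delta> \<longrightarrow> \<bar>f y - f x\<bar> \<le> \<epsilon> * \<bar>y - x\<bar>)" (is "?L \<longleftrightarrow> ?R")
proof
  assume L: ?L
  show ?R
  proof (intro allI impI)
    fix \<epsilon> :: real assume "\<epsilon> > 0"
    then obtain \<delta> where \<delta>: "\<delta> > 0" "\<And>y. y \<noteq> x \<Longrightarrow> \<bar>y - x\<bar> < \<delta> \<Longrightarrow> \<bar>(f y - f x) / (y - x)\<bar> < \<epsilon>"
      using L unfolding has_field_derivative_iff LIM_def dist_real_def by force
    have "\<bar>f y - f x\<bar> \<le> \<epsilon> * \<bar>y - x\<bar>" if "\<bar>y - x\<bar> < \<delta>" for y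
      using \<delta>(2)[OF _ that] by (cases "y = x") (simp_all add: abs_divide pos_divide_less_eq)
    then show "\<exists>\<delta>>0. \<forall>y. \<bar>y - x\<bar> < \<delta> \<longrightarrow> \<bar>f y - f x\<bar> \<le> \<epsilon> * \<bar>y - x\<bar>" using \<delta>(1) by blast
  qed
next
  assume R: ?R
  show ?L
    unfolding has_field_derivative_iff LIM_def dist_real_def
  proof (intro allI impI)
    fix \<epsilon> :: real assume e: "\<epsilon> > 0"
    then obtain \<delta> where \<delta>: "\<delta> > 0" "\<And>y. \<bar>y - x\<bar> < \<delta> \<Longrightarrow> \<bar>f y - f x\<bar> \<le> \<epsilon> / 2 * \<bar>y - x\<bar>"
      using R[rule_format, of "\<epsilon> / 2"] by auto
    have "\<bar>(f y - f x) / (y - x) - 0\<bar> < \<epsilon>" if "y \<noteq> x" "\<bar>y - x\<bar> < \<delta>" for y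
    proof -
      have "\<bar>f y - f x\<bar> / \<bar>y - x\<bar> \<le> \<epsilon> / 2" using \<delta>(2)[OF that(2)] that by (simp add: pos_divide_le_eq)
      then show ?thesis using e unfolding diff_zero abs_divide by linarith
    qed
    then show "\<exists>\<delta>>0. \<forall>y. y \<noteq> x \<and> \<bar>y - x\<bar> < \<delta> \<longrightarrow> \<bar>(f y - f x) / (y - x) - 0\<bar> < \<epsilon>" using \<delta>(1) by blast
  qed
qed

context cf_expansion
begin

text \<open>Denominators grow at least linearly; this crude rate is enough to make the segments
  around x shrink.\<close>

lemma segment_length: "\<bar>semiconvergent n 1 - convergent n\<bar> \<le> 1 / (real n + 1)"
proof -
  have q: "real (Q (Suc n)) \<ge> 1" using Q_pos[of n] by simp
  have "real (Q (Suc n)) + real (Q n) \<ge> real n + 1"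
  proof (cases n)
    case (Suc k)
    then have "real n \<le> real (Q (Suc n))" "1 \<le> real (Q n)" using Q_ge[of n] Q_pos[of k] unfolding Suc of_nat_le_iff
      by (simp_all del: cden.simps)
    then show ?thesis by linarith
  qed (use q in simp)
  then have "1 * (real n + 1) \<le> real (Q (Suc n)) * (real (Q (Suc n)) + real (Q n))"
    using q by (intro mult_mono) auto
  then show ?thesis unfolding semiconvergent_dist[OF order_refl] using q
    by (intro divide_left_mono) (auto intro!: mult_pos_pos)
qed

text \<open>As x splits the segment, the derivative bounds at its two ends add up to a bound for its
  whole increment. That increment is \<open>1 / 2 ^ S\<close> over a length
  \<open>1 / (q * (q + q'))\<close>, so \<open>q\<^sup>2 / 2 ^ S\<close> is small.\<close>

lemma ratio_tendsto_zero:
  assumes "(question_mark has_real_derivative 0) (at (r 0))"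
  shows "(\<lambda>n. (real (Q (Suc n)))\<^sup>2 / 2 ^ sum a {1..n}) \<longlonglongrightarrow> 0"
proof (rule LIMSEQ_I)
  let ?f = question_mark
  fix \<epsilon> :: real assume e: "\<epsilon> > 0"
  then obtain \<delta> where \<delta>: "\<delta> > 0" "\<And>y. \<bar>y - r 0\<bar> < \<delta> \<Longrightarrow> \<bar>?f y - ?f (r 0)\<bar> \<le> \<epsilon> / 2 * \<bar>y - r 0\<bar>"
    using assms[unfolded has_real_derivative_zero_iff, rule_format, of "\<epsilon> / 2"] by auto
  obtain N where N: "1 / (real N + 1) < \<delta>"
    using nat_approx_posE[OF \<delta>(1)] by (metis of_nat_Suc add.commute)
  show "\<exists>N. \<forall>n\<ge>N. norm ((real (Q (Suc n)))\<^sup>2 / 2 ^ sum a {1..n} - 0) < \<epsilon>"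
  proof (intro exI allI impI)
    fix n assume "N \<le> n"
    then have "1 / (real n + 1) \<le> 1 / (real N + 1)" by (intro divide_left_mono) auto
    then have len: "\<bar>semiconvergent n 1 - convergent n\<bar> < \<delta>" using segment_length[of n] N by linarith
    have seg: "r 0 \<in> closed_segment (convergent n) (semiconvergent n 1)" using x_in_segment(1)[of 1 n] a_pos by simp
    have split: "\<bar>semiconvergent n 1 - convergent n\<bar> = \<bar>semiconvergent n 1 - r 0\<bar> + \<bar>convergent n - r 0\<bar>"
      using seg by (auto simp: closed_segment_eq_real_ivl split: if_splits)
    have "\<bar>semiconvergent n 1 - r 0\<bar> < \<delta>" "\<bar>convergent n - r 0\<bar> < \<delta>" using split len by linarith+
    then have "\<bar>?f (semiconvergent n 1) - ?f (r 0)\<bar> \<le> \<epsilon> / 2 * \<bar>semiconvergent n 1 - r 0\<bar>" "\<bar>?f (convergent n) - ?f (r 0)\<bar> \<le> \<epsilon> / 2 * \<bar>convergent n - r 0\<bar>"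
      using \<delta>(2) by blast+
    moreover have "\<epsilon> / 2 * \<bar>semiconvergent n 1 - convergent n\<bar> = \<epsilon> / 2 * \<bar>semiconvergent n 1 - r 0\<bar> + \<epsilon> / 2 * \<bar>convergent n - r 0\<bar>"
      unfolding split by (rule distrib_left)
    ultimately have "\<bar>?f (semiconvergent n 1) - ?f (convergent n)\<bar> \<le> \<epsilon> / 2 * \<bar>semiconvergent n 1 - convergent n\<bar>" by linarith
    then have le: "1 / 2 ^ sum a {1..n} \<le> \<epsilon> / 2 * (1 / (real (Q (Suc n)) * (real (Q (Suc n)) + real (Q n))))"
      unfolding question_mark_gap[OF order_refl] semiconvergent_dist[OF order_refl] by simp
    have q: "real (Q (Suc n)) > 0" using Q_pos[of n] by simp
    have "(real (Q (Suc n)))\<^sup>2 * (1 / 2 ^ sum a {1..n}) \<le> (real (Q (Suc n)) * (real (Q (Suc n)) + real (Q n))) * (1 / 2 ^ sum a {1..n})"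
      using q by (intro mult_right_mono) (auto simp: power2_eq_square)
    also have "\<dots> \<le> (real (Q (Suc n)) * (real (Q (Suc n)) + real (Q n))) *
       (\<epsilon> / 2 * (1 / (real (Q (Suc n)) * (real (Q (Suc n)) + real (Q n)))))"
      using q by (intro mult_left_mono[OF le]) auto
    also have "\<dots> = \<epsilon> / 2"
    proof -
      have "real (Q (Suc n)) * (real (Q (Suc n)) + real (Q n)) \<noteq> 0" using q
        by (metis add_nonneg_eq_0_iff less_irrefl mult_eq_0_iff of_nat_0_le_iff)
      then show ?thesis by simp
    qed
    finally have "(real (Q (Suc n)))\<^sup>2 / 2 ^ sum a {1..n} \<le> \<epsilon> / 2" by (simp only: times_divide_eq_right mult.right_neutral)
    moreover have "0 \<le> (real (Q (Suc n)))\<^sup>2 / 2 ^ sum a {1..n}" by simp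
    ultimately show "norm ((real (Q (Suc n)))\<^sup>2 / 2 ^ sum a {1..n} - 0) < \<epsilon>"
      unfolding diff_zero real_norm_def using e by linarith
  qed
qed

text \<open>Lets the increment at the b-th semiconvergent, which decays like
  \<open>1 / 2 ^ b\<close>, absorb the square of its denominator uniformly in b.\<close>

lemma two_power_bound: "1 \<le> b \<Longrightarrow> (real b + 2)\<^sup>2 \<le> 8 * 2 ^ b"
proof (induction b rule: dec_induct)
  case (step b)
  have "1 \<le> real b" using step.hyps by simp
  moreover from this have "0 \<le> real b * real b" by simp
  ultimately have "1 \<le> real b * real b + real b * 2" by linarith
  then have "(real (Suc b) + 2)\<^sup>2 \<le> 2 * (real b + 2)\<^sup>2"
    by (simp add: power2_eq_square algebra_simps)
  then show ?case using step by simp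
qed (simp add: power2_eq_square)

text \<open>By \<open>out\<close>, y lies in the b-th segment but not in the next one, whose new end
  is the mediant \<open>?m\<close>; so \<open>?m\<close> separates y from x. For
  \<open>b = a (Suc t)\<close> the next segment belongs to level t + 1 and x lies on the other side
  of \<open>?m\<close>. The factor 16 is the 2 of \<open>question_mark_gap\<close> times the 8 of
  \<open>two_power_bound\<close>.\<close>

lemma slope_bound_in_segment:
  assumes b: "1 \<le> b" "b \<le> a (Suc t)"
    and y: "y \<in> closed_segment (convergent t) (semiconvergent t b)"
    and out: "if b = a (Suc t) then y \<notin> closed_segment (convergent (Suc t)) (semiconvergent (Suc t) 1)
              else y \<notin> closed_segment (convergent t) (semiconvergent t (Suc b))"
  shows "\<bar>question_mark y - question_mark (r 0)\<bar> \<le>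
    16 * ((real (Q (Suc t)))\<^sup>2 / 2 ^ sum a {1..t}) * \<bar>y - r 0\<bar>"
proof -
  let ?f = question_mark
  let ?m = "semiconvergent t (Suc b)"
  have fn: "farey_neighbours (P (Suc t)) (Q (Suc t)) (b * P (Suc t) + P t) (b * Q (Suc t) + Q t)"
    by (rule farey_neighbours_semiconvergent[OF b(1)])
  have m: "?m = real (P (Suc t) + (b * P (Suc t) + P t)) / real (Q (Suc t) + (b * Q (Suc t) + Q t))"
    by (simp add: semiconvergent_def add_ac)
  have m_in: "?m \<in> closed_segment (convergent t) (semiconvergent t b)"
    using mediant_in_segment[OF fn, of 1] m by (simp add: semiconvergent_def convergent_def)
  have K: "\<bar>?f y - ?f (r 0)\<bar> \<le>
    \<bar>?f (semiconvergent t b) - ?f (convergent t)\<bar> * (real (Q (Suc t)) + real (b * Q (Suc t) + Q t))\<^sup>2 * \<bar>y - r 0\<bar>"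
  proof (cases "b = a (Suc t)")
    case True
    have x: "r 0 \<in> closed_segment ?m (semiconvergent t b)"
      using x_in_segment(1)[of 1 "Suc t"] a_pos True
      by (simp add: semiconvergent_last semiconvergent_next closed_segment_commute)
    have y': "y \<in> closed_segment (convergent t) ?m"
      using y m_in out True by (auto simp: semiconvergent_last semiconvergent_next closed_segment_eq_real_ivl split: if_splits)
    show ?thesis
      using question_mark_slope_across_mediant[OF fn m, of y "r 0"] x y'
      by (simp add: semiconvergent_def convergent_def)
  next
    case False
    then have x: "r 0 \<in> closed_segment (convergent t) ?m" using x_in_segment(1)[of "Suc b" t] b by simp
    have y': "y \<in> closed_segment ?m (semiconvergent t b)"
      using y m_in out False by (auto simp: closed_segment_eq_real_ivl split: if_splits)
    show ?thesis
      using question_mark_slope_across_mediant[OF fn m, of "r 0" y] x y'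
      by (simp add: semiconvergent_def convergent_def abs_minus_commute)
  qed
  have "real (Q (Suc t)) + real (b * Q (Suc t) + Q t) \<le> (real b + 2) * real (Q (Suc t))"
    using Q_mono[of t] by (simp add: algebra_simps)
  then have "(real (Q (Suc t)) + real (b * Q (Suc t) + Q t))\<^sup>2 \<le> ((real b + 2) * real (Q (Suc t)))\<^sup>2"
    by (intro power_mono) auto
  also have "\<dots> = (real b + 2)\<^sup>2 * (real (Q (Suc t)))\<^sup>2" by (rule power_mult_distrib)
  also have "\<dots> \<le> (8 * 2 ^ b) * (real (Q (Suc t)))\<^sup>2" by (intro mult_right_mono two_power_bound b(1)) auto
  finally have "\<bar>?f (semiconvergent t b) - ?f (convergent t)\<bar> * (real (Q (Suc t)) + real (b * Q (Suc t) + Q t))\<^sup>2 * \<bar>y - r 0\<bar> \<le>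
    \<bar>?f (semiconvergent t b) - ?f (convergent t)\<bar> * ((8 * 2 ^ b) * (real (Q (Suc t)))\<^sup>2) * \<bar>y - r 0\<bar>"
    by (intro mult_right_mono mult_left_mono) auto
  also have "\<dots> = 16 * ((real (Q (Suc t)))\<^sup>2 / 2 ^ sum a {1..t}) * \<bar>y - r 0\<bar>"
    unfolding question_mark_gap[OF b(1)] by (simp add: power_add)
  finally show ?thesis using K by linarith
qed

text \<open>For y near x, take the last level t whose segment contains y and the last semiconvergent
  b there for which y is still inside. Then \<open>slope_bound_in_segment\<close> applies, and
  closeness of y forces \<open>N \<le> t\<close>, where the ratio is small.\<close>

lemma derivative_zeroI:
  assumes lim: "(\<lambda>n. (real (Q (Suc n)))\<^sup>2 / 2 ^ sum a {1..n}) \<longlonglongrightarrow> 0"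
  shows "(question_mark has_real_derivative 0) (at (r 0))"
  unfolding has_real_derivative_zero_iff
proof (intro allI impI)
  let ?f = question_mark
  fix \<epsilon> :: real assume e: "\<epsilon> > 0"
  obtain N where N: "\<And>n. n \<ge> N \<Longrightarrow> (real (Q (Suc n)))\<^sup>2 / 2 ^ sum a {1..n} < \<epsilon> / 16"
    using LIMSEQ_D[OF lim, of "\<epsilon> / 16"] e by auto
  define I where "I n = closed_segment (convergent n) (semiconvergent n 1)" for n
  have xI: "r 0 \<in> I n" "r 0 \<noteq> convergent n" "r 0 \<noteq> semiconvergent n 1" for n
    using x_in_segment[of 1 n] a_pos by (auto simp: I_def)
  \<comment> \<open>The distance from x to the nearer end of \<open>I N\<close>, so that every
    closer y lies in \<open>I N\<close>.\<close>
  define \<delta> where "\<delta> = min \<bar>r 0 - convergent N\<bar> \<bar>r 0 - semiconvergent N 1\<bar>"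
  have "\<delta> > 0" using xI[of N] by (simp add: \<delta>_def)
  moreover have "\<bar>?f y - ?f (r 0)\<bar> \<le> \<epsilon> * \<bar>y - r 0\<bar>" if y: "\<bar>y - r 0\<bar> < \<delta>" for y
  proof (cases "y = r 0")
    case False
    then have d: "\<bar>y - r 0\<bar> > 0" by simp
    have yN: "y \<in> I N"
      using y xI[of N] unfolding I_def \<delta>_def by (auto simp: closed_segment_eq_real_ivl split: if_splits)
    define A where "A = {n. y \<in> I n}"
    \<comment> \<open>A segment containing x and y is at least as long as their distance, and the
      lengths tend to 0, so y lies in only finitely many of them.\<close>
    have "n \<le> nat \<lceil>1 / \<bar>y - r 0\<bar>\<rceil>" if "n \<in> A" for n
    proof -
      have "\<bar>y - r 0\<bar> \<le> \<bar>semiconvergent n 1 - convergent n\<bar>"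
        using that xI(1)[of n] unfolding A_def I_def by (auto simp: closed_segment_eq_real_ivl split: if_splits)
      then have "\<bar>y - r 0\<bar> \<le> 1 / (real n + 1)" using segment_length[of n] by linarith
      then have "real n + 1 \<le> 1 / \<bar>y - r 0\<bar>" using d
        by (simp add: pos_le_divide_eq mult.commute)
      then show ?thesis by linarith
    qed
    then have finA: "finite A" by (meson finite_nat_set_iff_bounded_le)
    define t where "t = Max A"
    have tA: "t \<in> A" using finA yN unfolding t_def A_def by (intro Max_in) auto
    have tN: "N \<le> t" using finA yN unfolding t_def A_def by (intro Max_ge) auto
    have tS: "Suc t \<notin> A"
    proof
      assume "Suc t \<in> A"
      then have "Suc t \<le> t" unfolding t_def using finA by (intro Max_ge) auto
      then show False by simp
    qed
    define B where "B = {b \<in> {1..a (Suc t)}. y \<in> closed_segment (convergent t) (semiconvergent t b)}"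
    have finB: "finite B" by (simp add: B_def)
    have "1 \<in> B" using tA a_pos[of t] by (simp add: A_def B_def I_def)
    then have "Max B \<in> B" using finB by (intro Max_in) auto
    then have b: "1 \<le> Max B" "Max B \<le> a (Suc t)" "y \<in> closed_segment (convergent t) (semiconvergent t (Max B))"
      by (auto simp: B_def)
    have bS: "Suc (Max B) \<notin> B"
    proof
      assume "Suc (Max B) \<in> B"
      then have "Suc (Max B) \<le> Max B" using finB by (intro Max_ge) auto
      then show False by simp
    qed
    have "\<bar>?f y - ?f (r 0)\<bar> \<le> 16 * ((real (Q (Suc t)))\<^sup>2 / 2 ^ sum a {1..t}) * \<bar>y - r 0\<bar>"
    proof (rule slope_bound_in_segment[OF b])
      show "if Max B = a (Suc t) then y \<notin> closed_segment (convergent (Suc t)) (semiconvergent (Suc t) 1)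
              else y \<notin> closed_segment (convergent t) (semiconvergent t (Suc (Max B)))"
        using tS bS b(2) by (auto simp: A_def B_def I_def)
    qed
    also have "\<dots> \<le> \<epsilon> * \<bar>y - r 0\<bar>"
      using N[OF tN] by (intro mult_right_mono) linarith+
    finally show ?thesis .
  qed simp
  ultimately show "\<exists>\<delta>>0. \<forall>y. \<bar>y - r 0\<bar> < \<delta> \<longrightarrow> \<bar>?f y - ?f (r 0)\<bar> \<le> \<epsilon> * \<bar>y - r 0\<bar>" by blast
qed

end


subsection \<open>Lower bound for the excess\<close>

text \<open>The amount by which \<open>ln (golden_norm\<^sup>2 / 2 ^ S)\<close> rises at each
  partial quotient equal to 1.\<close>

definition golden_gap :: real where
  "golden_gap = 2 * ln lambda1 - ln 2"

lemma golden_gap_pos: "0 < golden_gap" and golden_gap_le_1: "golden_gap \<le> 1"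
proof -
  have sq: "2 * ln lambda1 = ln (lambda1 + 1)"
    using lambda1_bounds by (simp add: lambda1_sq[symmetric] ln_realpow)
  have "ln 2 < ln (lambda1 + 1)" using lambda1_bounds by simp
  then show "0 < golden_gap" by (simp add: golden_gap_def sq)
  have "golden_gap = ln ((lambda1 + 1) / 2)"
    using lambda1_bounds by (simp add: golden_gap_def sq ln_div)
  also have "\<dots> \<le> (lambda1 + 1) / 2 - 1" using lambda1_bounds by (intro ln_le_minus_one) auto
  also have "\<dots> \<le> 1" using lambda1_bounds by simp
  finally show "golden_gap \<le> 1" .
qed

lemma kappa1_eq: "kappa1 = 1 + golden_gap / ln 2"
  by (simp add: kappa1_def golden_gap_def field_simps)

text \<open>Concavity of \<open>ln\<close>, used with B a common bound for all
  \<open>a i - 1\<close>: it replaces a sum of logarithms by a multiple of the sum of the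
  \<open>a i - 1\<close>.\<close>

lemma ln_chord_le:
  fixes y B c :: real
  assumes "0 \<le> y" "y \<le> B" "0 < B" "0 < c"
  shows "y / B * ln (1 + B / c) \<le> ln (1 + y / c)"
proof -
  have "(1 - y / B) * ln 1 + (y / B) * ln (1 + B / c) \<le> ln ((1 - y / B) *\<^sub>R 1 + (y / B) *\<^sub>R (1 + B / c))"
    using assms by (intro concave_onD[OF ln_concave]) (auto intro!: add_pos_nonneg)
  also have "(1 - y / B) *\<^sub>R 1 + (y / B) *\<^sub>R (1 + B / c) = 1 + y / c"
    using assms by (simp add: field_simps)
  finally show ?thesis by simp
qed

text \<open>The inequality bounds B below in terms of itself and is iterated three times from
  \<open>B \<ge> 1\<close>. This yields first \<open>e * sqrt t\<close>, then
  \<open>sqrt (k * t * ln t)\<close> up to a constant added to \<open>ln t\<close>, and finally a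
  further \<open>ln (ln t)\<close> added to \<open>ln t\<close>. That surplus outgrows every
  constant \<open>K\<close>.\<close>

lemma self_improving_bound:
  fixes k c K :: real
  assumes "0 < k" "0 < c"
  shows "\<forall>\<^sub>F t in sequentially. \<forall>B\<ge>1. 2 * k * real t * ln (1 + B / c) \<le> B\<^sup>2 \<longrightarrow>
    sqrt (k * real t * ln (real t)) \<le> B - K"
proof -
  define e where "e = sqrt (2 * k * ln (1 + 1 / c))"
  have "0 < ln (1 + 1 / c)" using assms by (intro ln_gt_zero) simp
  then have e: "0 < e" using assms by (simp add: e_def)
  have "\<forall>\<^sub>F t::nat in sequentially. sqrt (2*k*real t * ln (1 + sqrt (2*k*real t*ln (1 + e * sqrt (real t) / c))/c)) - K
      \<ge> sqrt (k * real t * ln (real t))"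
    using assms e by real_asymp
  then show ?thesis
  proof eventually_elim
    case (elim t)
    show ?case
    proof (intro allI impI)
      fix B :: real assume B: "1 \<le> B" and le: "2 * k * real t * ln (1 + B / c) \<le> B\<^sup>2"
      have step: "sqrt (2 * k * real t * ln (1 + z / c)) \<le> B" if "0 \<le> z" "z \<le> B" for z
      proof -
        have "2 * k * real t * ln (1 + z / c) \<le> 2 * k * real t * ln (1 + B / c)"
          using that assms by (intro mult_left_mono ln_mono add_left_mono divide_right_mono) (auto intro: add_pos_nonneg)
        then show ?thesis using le B by (intro real_le_lsqrt) auto
      qed
      have "e * sqrt (real t) = sqrt (2 * k * real t * ln (1 + 1 / c))"
        unfolding e_def by (simp add: real_sqrt_mult mult_ac)
      then have "e * sqrt (real t) \<le> B" using step[of 1] B by simp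
      then have "sqrt (2*k*real t*ln (1 + e * sqrt (real t) / c)) \<le> B" using e by (intro step) auto
      moreover have "0 \<le> sqrt (2*k*real t*ln (1 + e * sqrt (real t) / c))"
        using assms e by simp
      ultimately have "sqrt (2*k*real t * ln (1 + sqrt (2*k*real t*ln (1 + e * sqrt (real t) / c))/c)) \<le> B"
        by - (rule step; assumption)
      then show "sqrt (k * real t * ln (real t)) \<le> B - K" using elim by linarith
    qed
  qed
qed

context cf_word
begin

definition excess :: "nat \<Rightarrow> real" where
  "excess n = real (sum a {1..n}) - kappa1 * real n"

text \<open>Take logarithms of squares in \<open>golden_norm_lower\<close>; the threshold
  \<open>1 / lambda1\<^sup>2\<close> compensates the factor \<open>lambda1\<close> lost in
  \<open>golden_norm_le_Q\<close>.\<close>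

lemma ln_gain_le_excess:
  assumes "(real (Q (Suc n)))\<^sup>2 / 2 ^ sum a {1..n} \<le> 1 / lambda1\<^sup>2"
  shows "(\<Sum>i=1..n. ln (1 + (real (a i) - 1) / lambda1\<^sup>2)) \<le> ln 2 / 2 * excess n"
proof -
  let ?G = "\<Prod>i=1..n. 1 + (real (a i) - 1) / lambda1\<^sup>2"
  have l: "lambda1 > 0" using lambda1_bounds by simp
  have factor: "1 + (real (a i) - 1) / lambda1\<^sup>2 > 0" if "i \<in> {1..n}" for i
    using one_le_a[of i] that by (intro add_pos_nonneg) auto
  have G: "?G > 0" using factor by (intro prod_pos)
  have "lambda1 ^ n * ?G \<le> lambda1 * real (Q (Suc n))"
    using golden_norm_lower[of n] golden_norm_le_Q[of n] by linarith
  then have "(lambda1 ^ n * ?G)\<^sup>2 \<le> (lambda1 * real (Q (Suc n)))\<^sup>2"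
    using l G by (intro power_mono) auto
  also have "\<dots> \<le> 2 ^ sum a {1..n}"
    using assms l by (simp add: power_mult_distrib pos_le_divide_eq pos_divide_le_eq mult_ac)
  finally have le: "(lambda1 ^ n * ?G)\<^sup>2 \<le> 2 ^ sum a {1..n}" .
  have "0 < lambda1 ^ n * ?G" using l G by (intro mult_pos_pos zero_less_power)
  then have "ln ((lambda1 ^ n * ?G)\<^sup>2) \<le> ln (2 ^ sum a {1..n})"
    by (intro ln_mono le zero_less_power zero_less_numeral)
  moreover have "ln ((lambda1 ^ n * g)\<^sup>2) = 2 * (real n * ln lambda1 + ln g)" if "0 < g" for g
    using l that by (simp add: ln_realpow ln_mult)
  from this[OF G] have "ln ((lambda1 ^ n * ?G)\<^sup>2) = 2 * (real n * ln lambda1 + ln ?G)" .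
  moreover have "ln ?G = (\<Sum>i=1..n. ln (1 + (real (a i) - 1) / lambda1\<^sup>2))"
  proof (rule ln_prod)
    show "1 + (real (a i) - 1) / lambda1\<^sup>2 \<noteq> 0" if "i \<in> {1..n}" for i using factor[OF that] by simp
  qed simp
  ultimately have "2 * (real n * ln lambda1 + (\<Sum>i=1..n. ln (1 + (real (a i) - 1) / lambda1\<^sup>2))) \<le>
      real (sum a {1..n}) * ln 2"
    by (simp only: ln_realpow)
  moreover have "ln 2 / 2 * excess n = real (sum a {1..n}) * ln 2 / 2 - real n * ln lambda1"
    by (simp add: excess_def kappa1_def algebra_simps)
  moreover have "y \<le> w" if "2 * (x + y) \<le> z" "w = z / 2 - x" for w x y z :: real
    using that by simp
  ultimately show ?thesis by blast
qed

lemma Max_excess_lower: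
  assumes lim: "(\<lambda>n. (real (Q (Suc n)))\<^sup>2 / 2 ^ sum a {1..n}) \<longlonglongrightarrow> 0"
  shows "\<forall>\<^sub>F t in sequentially. sqrt golden_gap / ln 2 * sqrt (real t * ln (real t)) \<le> Max (excess ` {1..t})"
proof -
  \<comment> \<open>Chosen so that \<open>kappa1 - 1 = k * ln 2\<close>; its square root is the
    constant of the claim.\<close>
  define k where "k = golden_gap / (ln 2)\<^sup>2"
  have k: "k > 0" using golden_gap_pos by (simp add: k_def)
  have l: "lambda1\<^sup>2 > 0" using lambda1_bounds by simp
  have ln2: "ln (2::real) > 0" by simp
  have \<kappa>: "kappa1 > 1" unfolding kappa1_eq using golden_gap_pos by simp
  have "\<forall>\<^sub>F n in sequentially. (real (Q (Suc n)))\<^sup>2 / 2 ^ sum a {1..n} < 1 / lambda1\<^sup>2"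
    by (rule order_tendstoD(2)[OF lim]) (use l in simp)
  then obtain N where N: "\<And>n. N \<le> n \<Longrightarrow> (real (Q (Suc n)))\<^sup>2 / 2 ^ sum a {1..n} < 1 / lambda1\<^sup>2"
    unfolding eventually_sequentially by blast
  have gain: "(\<Sum>i=1..n. ln (1 + (real (a i) - 1) / lambda1\<^sup>2)) \<le> ln 2 / 2 * excess n" if "N \<le> n" for n
    using N[OF that] by (intro ln_gain_le_excess) simp
  have nonneg: "0 \<le> ln (1 + (real (a i) - 1) / lambda1\<^sup>2)" if "1 \<le> i" for i
    using one_le_a[OF that] by (intro ln_ge_zero) auto
  have excess_pos: "0 \<le> excess n" if "N \<le> n" for n
  proof -
    have "0 \<le> ln 2 / 2 * excess n" using gain[OF that] nonneg
      by (meson atLeastAtMost_iff order_trans sum_nonneg)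
    then show ?thesis using ln2 by (simp add: zero_le_mult_iff)
  qed
  have excess_ge: "- (kappa1 * real N) \<le> excess n" for n
  proof (cases "N \<le> n")
    case True
    have "0 \<le> kappa1 * real N" using \<kappa> by simp
    then show ?thesis using excess_pos[OF True] by linarith
  next
    case False
    then have "kappa1 * real n \<le> kappa1 * real N" using \<kappa> by (intro mult_left_mono) auto
    moreover have "0 \<le> real (sum a {1..n})" by (rule of_nat_0_le_iff)
    ultimately show ?thesis unfolding excess_def by linarith
  qed
  \<comment> \<open>Before \<open>N\<close> the excess may be negative, but never below
    \<open>- (kappa1 * N)\<close>; the other \<open>kappa1\<close> is the drift of one step. Hence
    \<open>M + K\<close> bounds every \<open>a u - 1\<close>.\<close>
  define K where "K = kappa1 * real N + kappa1"
  have K: "1 \<le> K" unfolding K_def using \<kappa> by (simp add: add_increasing)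
  have "\<forall>\<^sub>F t in sequentially. \<forall>B\<ge>1. 2 * k * real t * ln (1 + B / lambda1\<^sup>2) \<le> B\<^sup>2 \<longrightarrow>
    sqrt (k * real t * ln (real t)) \<le> B - K"
    by (rule self_improving_bound[OF k l])
  then show ?thesis using eventually_ge_at_top[of "max 1 N"]
  proof eventually_elim
    case (elim t)
    have t: "N \<le> t" "1 \<le> t" using elim(2) by auto
    define M where "M = Max (excess ` {1..t})"
    have M: "excess u \<le> M" if "1 \<le> u" "u \<le> t" for u
      unfolding M_def using that by (intro Max_ge) auto
    have M0: "0 \<le> M" using M[OF t(2) order_refl] excess_pos[OF t(1)] by linarith
    define B where "B = M + K"
    have B: "1 \<le> B" using M0 K by (simp add: B_def)
    have a_le: "real (a u) - 1 \<le> B" if u: "1 \<le> u" "u \<le> t" for u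
    proof -
      obtain v where v: "u = Suc v" using u by (cases u) auto
      have "real (a u) = excess u - excess v + kappa1" by (simp add: v excess_def algebra_simps)
      then show ?thesis using M[OF u] excess_ge[of v] unfolding B_def K_def by linarith
    qed
    \<comment> \<open>Nonnegative excess at t means that the \<open>a i - 1\<close> sum to at least
      \<open>(kappa1 - 1) * t\<close>. By concavity the logarithms are smallest when each
      \<open>a i - 1\<close> is 0 or B, which gives this left side.\<close>
    have "(kappa1 - 1) * real t / B * ln (1 + B / lambda1\<^sup>2) \<le>
      (real (sum a {1..t}) - real t) / B * ln (1 + B / lambda1\<^sup>2)"
    proof -
      have "(kappa1 - 1) * real t \<le> real (sum a {1..t}) - real t"
        using excess_pos[OF t(1)] by (simp add: excess_def algebra_simps)
      then show ?thesis using B l by (intro mult_right_mono divide_right_mono ln_ge_zero) auto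
    qed
    also have "\<dots> = (\<Sum>i=1..t. (real (a i) - 1) / B * ln (1 + B / lambda1\<^sup>2))"
      by (simp add: sum_distrib_right[symmetric] sum_divide_distrib[symmetric] sum_subtractf)
    also have "\<dots> \<le> (\<Sum>i=1..t. ln (1 + (real (a i) - 1) / lambda1\<^sup>2))"
    proof (rule sum_mono)
      fix i assume i: "i \<in> {1..t}"
      then show "(real (a i) - 1) / B * ln (1 + B / lambda1\<^sup>2) \<le> ln (1 + (real (a i) - 1) / lambda1\<^sup>2)"
        using one_le_a[of i] a_le[of i] B l by (intro ln_chord_le) auto
    qed
    also have "\<dots> \<le> ln 2 / 2 * excess t" by (rule gain[OF t(1)])
    also have "\<dots> \<le> ln 2 / 2 * B"
      using M[OF t(2) order_refl] K unfolding B_def by (intro mult_left_mono) auto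
    finally have "(kappa1 - 1) * real t * ln (1 + B / lambda1\<^sup>2) \<le> ln 2 / 2 * B * B"
      using B by (simp add: pos_divide_le_eq)
    moreover have "kappa1 - 1 = k * ln 2" by (simp add: kappa1_eq k_def power2_eq_square)
    ultimately have "ln 2 * (2 * k * real t * ln (1 + B / lambda1\<^sup>2)) \<le> ln 2 * B\<^sup>2"
      by (simp add: power2_eq_square mult_ac)
    then have "2 * k * real t * ln (1 + B / lambda1\<^sup>2) \<le> B\<^sup>2"
      using ln2 by (simp only: mult_le_cancel_left_pos)
    then have "sqrt (k * real t * ln (real t)) \<le> M" using elim(1) B by (auto simp: B_def)
    moreover have "sqrt (k * real t * ln (real t)) = sqrt golden_gap / ln 2 * sqrt (real t * ln (real t))"
      by (simp add: k_def real_sqrt_mult real_sqrt_divide)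
    ultimately show ?case by (simp add: M_def)
  qed
qed

text \<open>\<open>F n y\<close> is the continued fraction with n partial quotients of the word and
  tail y. The images of [0,1] are nested and compact, a common point is the number sought, and its
  tails satisfy the recursion because each \<open>F n\<close> is injective.\<close>

lemma cf_expansion_exists: "\<exists>r. cf_expansion a r"
proof -
  define F where "F n y = (real (P (Suc n)) + y * real (P n)) / (real (Q (Suc n)) + y * real (Q n))" for n y
  have den: "0 < real (Q (Suc n)) + y * real (Q n)" if "0 \<le> y" for n y
    using Q_pos[of n] that by (simp add: add_pos_nonneg)
  have F_inj: "y = z" if "F n y = F n z" "0 \<le> y" "0 \<le> z" for n y z
  proof -
    have "(real (P (Suc n)) + y * real (P n)) * (real (Q (Suc n)) + z * real (Q n)) =
      (real (P (Suc n)) + z * real (P n)) * (real (Q (Suc n)) + y * real (Q n))"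
      using that(1) den[OF that(2), of n] den[OF that(3), of n] unfolding F_def
      by (subst (asm) frac_eq_eq) auto
    then have "(real (P n) * real (Q (Suc n)) - real (P (Suc n)) * real (Q n)) * (y - z) = 0"
      by (simp add: algebra_simps)
    moreover have "real (P n) * real (Q (Suc n)) - real (P (Suc n)) * real (Q n) \<noteq> 0"
      using det_cases[of n] by (metis Suc_eq_plus1 eq_iff_diff_eq_0 n_not_Suc_n of_nat_eq_iff of_nat_mult)
    ultimately show ?thesis by simp
  qed
  have F_Suc: "F (Suc n) y = F n (1 / (real (a (Suc n)) + y))" if "0 \<le> y" for n y
  proof -
    define s where "s = real (a (Suc n)) + y"
    have s: "s > 0" using that a_pos[of n] by (simp add: s_def add_pos_nonneg)
    have "F n (1 / s) = (s * (real (P (Suc n)) + 1 / s * real (P n))) / (s * (real (Q (Suc n)) + 1 / s * real (Q n)))"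
      using s by (simp add: F_def)
    also have "\<dots> = (s * real (P (Suc n)) + real (P n)) / (s * real (Q (Suc n)) + real (Q n))"
      using s by (simp add: algebra_simps)
    finally show ?thesis by (simp add: s_def F_def algebra_simps)
  qed
  have inv: "1 / (real (a (Suc n)) + y) \<in> {0..1}" if "0 \<le> y" for n y
    using that a_pos[of n] by (auto simp: divide_le_eq)
  have nest: "F (Suc n) ` {0..1} \<subseteq> F n ` {0..1}" for n
    using F_Suc inv by (auto intro!: imageI)
  have "\<Inter>(range (\<lambda>n. F n ` {0..1})) \<noteq> {}"
  proof (rule compact_nest)
    show "compact (F n ` {0..1})" for n
    proof (rule compact_continuous_image)
      show "continuous_on {0..1} (F n)"
        unfolding F_def by (intro continuous_intros ballI) (use den[of _ n] in force)
    qed simp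
    show "F n ` {0..1} \<subseteq> F m ` {0..1}" if "m \<le> n" for m n
      by (rule lift_Suc_antimono_le[of "\<lambda>n. F n ` {0..1}", OF nest that])
  qed simp
  then obtain x where "\<And>n. x \<in> F n ` {0..1}" by auto
  then have "\<forall>n. \<exists>y\<in>{0..1}. x = F n y" by (auto simp: image_iff)
  then obtain y where y: "\<And>n. y n \<in> {0..1}" "\<And>n. x = F n (y n)" by metis
  have y_Suc: "y n = 1 / (real (a (Suc n)) + y (Suc n))" for n
  proof (rule F_inj)
    have y0: "0 \<le> y k" for k using y(1)[of k] by simp
    show "F n (y n) = F n (1 / (real (a (Suc n)) + y (Suc n)))"
      using F_Suc[OF y0[of "Suc n"], of n] y(2)[of n] y(2)[of "Suc n"] by argo
    show "0 \<le> y n" by (rule y0)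
    show "0 \<le> 1 / (real (a (Suc n)) + y (Suc n))" using inv[OF y0[of "Suc n"], of n] by simp
  qed
  \<comment> \<open>Compactness only places the tails in [0,1]. The recursion makes them positive,
    and positivity of the next tail then makes each less than 1.\<close>
  have y_pos: "0 < y n" for n
  proof -
    have "0 < real (a (Suc n)) + y (Suc n)" using y(1)[of "Suc n"] a_pos[of n] by (intro add_pos_nonneg) auto
    then show ?thesis by (subst y_Suc) simp
  qed
  have y_less: "y n < 1" for n
  proof -
    have "1 < real (a (Suc n)) + y (Suc n)" using y_pos[of "Suc n"] a_pos[of n] by linarith
    then show ?thesis by (subst y_Suc) simp
  qed
  have "cf_expansion a y" by unfold_locales (rule y_pos y_less y_Suc)+
  then show ?thesis by blast
qed

end

section \<open>Agreement of the tails with complete and partial quotients\<close>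

context cf_expansion
begin

lemma complete_quotient_r: "complete_quotient (r 0) (Suc n) = real (a (Suc n)) + r (Suc n)"
  and frac_complete_quotient_r: "frac (complete_quotient (r 0) n) = r n"
proof (induction n)
  case 0
  {
    case 2
    show ?case using r_bounds[of 0] by (simp add: frac_eq)
  next
    case 1
    show ?case using r_bounds[of 0] r_Suc[of 0] by (simp add: frac_eq)
  }
next
  case (Suc n)
  {
    case 2
    show ?case unfolding Suc(1) using r_bounds[of "Suc n"] by (simp add: frac_unique_iff)
  }
  note f = this
  case 1
  show ?case
    unfolding complete_quotient.simps(2)[of _ "Suc n"] f using r_Suc[of "Suc n"] by (simp del: complete_quotient.simps)
qed

lemma pq_sum_r: "pq_sum (r 0) t = int (sum a {1..t})"
proof -
  have "partial_quotient (r 0) i = int (a i)" if i: "i \<in> {1..t}" for i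
  proof -
    obtain j where j: "i = Suc j" using i by (cases i) auto
    show ?thesis unfolding partial_quotient_def j complete_quotient_r
      using r_bounds[of "Suc j"] by (intro floor_unique) auto
  qed
  then show ?thesis by (simp add: pq_sum_def)
qed

text \<open>Infinite descent: a tail u/v in (0,1) makes the next tail a fraction with the smaller
  denominator u.\<close>

lemma r_irrational: "r 0 \<notin> \<rat>"
proof
  assume "r 0 \<in> \<rat>"
  then obtain u v :: nat where "v \<noteq> 0" "\<bar>r 0\<bar> = real u / real v"
    by (rule Rats_abs_nat_div_natE)
  then have "v \<noteq> 0" "r 0 = real u / real v" using r_bounds(1)[of 0] by auto
  moreover have "v \<noteq> 0 \<Longrightarrow> r n \<noteq> real u / real v" for n u v
  proof (induction v arbitrary: u n rule: less_induct)
    case (less v)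
    show ?case
    proof
      assume eq: "r n = real u / real v"
      have u: "0 < u" "u < v" using r_bounds[of n] less.prems by (auto simp: eq zero_less_divide_iff)
      have pos: "0 < real (a (Suc n)) + r (Suc n)" using r_bounds(1)[of "Suc n"] by (simp add: add_nonneg_pos)
      have "real (a (Suc n)) + r (Suc n) = real v / real u"
        using r_Suc[of n] pos u less.prems unfolding eq by (simp add: field_simps)
      then have e: "r (Suc n) = (real v - real (a (Suc n)) * real u) / real u"
        using u by (simp add: field_simps)
      have "0 < real v - real (a (Suc n)) * real u"
        using r_bounds(1)[of "Suc n"] u unfolding e by (simp add: zero_less_divide_iff)
      then have "real (a (Suc n) * u) < real v" by simp
      then have "a (Suc n) * u < v" by (simp only: of_nat_less_iff)
      then have "r (Suc n) = real (v - a (Suc n) * u) / real u" unfolding e by (simp add: of_nat_diff)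
      then show False using less.IH[of u "Suc n"] u by blast
    qed
  qed
  ultimately show False by blast
qed

end

lemma cf_expansion_complete_quotient:
  assumes "x \<in> {0<..<1}" "x \<notin> \<rat>"
  shows "cf_expansion (\<lambda>n. nat (partial_quotient x n)) (\<lambda>n. frac (complete_quotient x n))"
proof
  show "1 \<le> nat (partial_quotient x (Suc n))" for n
    using partial_quotient_pos[OF assms(2), of n] by simp
  have "frac (complete_quotient x n) \<noteq> 0" for n
    using complete_quotient_irrational[OF assms(2), of n]
    by (auto simp: frac_eq_0_iff Ints_subset_Rats[THEN subsetD])
  then show "0 < frac (complete_quotient x n)" for n by (simp add: order_neq_le_trans)
  show "frac (complete_quotient x n) < 1" for n by (rule frac_lt_1)
  show "frac (complete_quotient x n) = 1 / (real (nat (partial_quotient x (Suc n))) + frac (complete_quotient x (Suc n)))" for n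
  proof -
    have "real (nat (partial_quotient x (Suc n))) = of_int \<lfloor>complete_quotient x (Suc n)\<rfloor>"
      using partial_quotient_pos[OF assms(2), of n] by (simp add: partial_quotient_def)
    then have "real (nat (partial_quotient x (Suc n))) + frac (complete_quotient x (Suc n)) = complete_quotient x (Suc n)"
      by (simp only: frac_def)
    then show ?thesis by simp
  qed
qed

lemma Max_pq_sum_excess_lower:
  assumes x: "x \<in> {0<..<1}" "x \<notin> \<rat>" and d: "(question_mark has_real_derivative 0) (at x)"
  shows "\<exists>T. \<forall>t\<ge>T. sqrt (2 * ln lambda1 - ln 2) / ln 2 * sqrt (real t * ln (real t))
     \<le> Max ((\<lambda>u. real_of_int (pq_sum x u) - kappa1 * real u) ` {1..t})"
proof -
  interpret cf_expansion "\<lambda>n. nat (partial_quotient x n)" "\<lambda>n. frac (complete_quotient x n)"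
    by (rule cf_expansion_complete_quotient[OF x])
  have r0: "frac (complete_quotient x 0) = x" using x by (simp add: frac_eq)
  have d': "(question_mark has_real_derivative 0) (at (frac (complete_quotient x 0)))"
    unfolding r0 by (rule d)
  have e: "excess u = real_of_int (pq_sum x u) - kappa1 * real u" for u
    unfolding excess_def pq_sum_r[unfolded r0] by (simp only: of_int_of_nat_eq)
  show ?thesis
    using Max_excess_lower[OF ratio_tendsto_zero[OF d']]
    unfolding golden_gap_def eventually_sequentially e .
qed


subsection \<open>A word with small excess\<close>

definition square_log :: "nat \<Rightarrow> real" where
  "square_log j = (real j)\<^sup>2 * ln (real j)"

text \<open>The summand j keeps the peaks strictly increasing after rounding; the other one makes
  \<open>golden_gap\<close> times the distance to the next peak asymptotic to 2 j ln j.\<close>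

definition peak :: "nat \<Rightarrow> nat" where
  "peak j = j + nat \<lceil>square_log j / golden_gap\<rceil>"

text \<open>Exceeds ln (1 + jump j / lambda1) by an unbounded amount, so that the ratios tend to 0.\<close>

definition reserve :: "nat \<Rightarrow> real" where
  "reserve j = ln (real j) + 2 * ln (1 + ln (real j))"

text \<open>The first term is the loss of \<open>golden_gap\<close> per step until the next peak.
  The reserve is doubled because denominators enter squared, and \<open>ln 2\<close> is what one
  unit of the sum of partial quotients pays.\<close>

definition jump :: "nat \<Rightarrow> nat" where
  "jump j = nat \<lceil>(golden_gap * (real (peak (Suc j)) - real (peak j)) + 2 * reserve j) / ln 2\<rceil>"

primrec peaks_upto :: "nat \<Rightarrow> nat" where
  "peaks_upto 0 = 0"
| "peaks_upto (Suc n) =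
    (if peak (Suc (peaks_upto n)) \<le> Suc n then Suc (peaks_upto n) else peaks_upto n)"

definition peak_word :: "nat \<Rightarrow> nat" where
  "peak_word n = 1 + (if peak (peaks_upto n) = n then jump (peaks_upto n) else 0)"

lemma square_log_nonneg: "0 \<le> square_log j"
  by (cases j) (auto simp: square_log_def)

lemma square_log_mono: "square_log j \<le> square_log (Suc j)"
proof (cases j)
  case (Suc i)
  then show ?thesis unfolding square_log_def by (intro mult_mono power_mono ln_mono) auto
qed (simp add: square_log_def)

lemma peak_less: "peak j < peak (Suc j)"
proof -
  have "nat \<lceil>square_log j / golden_gap\<rceil> \<le> nat \<lceil>square_log (Suc j) / golden_gap\<rceil>"
    using square_log_mono golden_gap_pos by (intro nat_mono ceiling_mono divide_right_mono) auto
  then show ?thesis unfolding peak_def by (intro add_less_le_mono) auto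
qed

lemma peak_0: "peak 0 = 0" and peak_1: "peak 1 = 1"
  by (simp_all add: peak_def square_log_def)

lemma peak_bounds:
  "square_log j / golden_gap \<le> real (peak j)"
  "real j + square_log j / golden_gap \<le> real (peak j)"
  "real (peak j) \<le> real j + square_log j / golden_gap + 1"
proof -
  have "0 \<le> square_log j / golden_gap" using square_log_nonneg golden_gap_pos by simp
  then show "square_log j / golden_gap \<le> real (peak j)" "real j + square_log j / golden_gap \<le> real (peak j)"
    "real (peak j) \<le> real j + square_log j / golden_gap + 1"
    unfolding peak_def of_nat_add by linarith+
qed

text \<open>The summand 2 bounds \<open>2 * golden_gap\<close>, which comes from the increment of
  the index and from the ceiling.\<close>

lemma peak_gap_le:
  "golden_gap * (real (peak (Suc j)) - real (peak j)) \<le> 2 + square_log (Suc j) - square_log j"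
proof -
  have "golden_gap * (real (peak (Suc j)) - real (peak j)) \<le>
      golden_gap * (2 + (square_log (Suc j) - square_log j) / golden_gap)"
    using peak_bounds[of j] peak_bounds[of "Suc j"] golden_gap_pos
    by (intro mult_left_mono) (auto simp: diff_divide_distrib)
  also have "\<dots> = 2 * golden_gap + (square_log (Suc j) - square_log j)"
    using golden_gap_pos by (simp add: distrib_left)
  finally show ?thesis using golden_gap_le_1 by linarith
qed

lemma reserve_nonneg: "1 \<le> j \<Longrightarrow> 0 \<le> reserve j"
  by (simp add: reserve_def)

lemma reserve_mono:
  assumes "1 \<le> i" "i \<le> j"
  shows "reserve i \<le> reserve j"
proof -
  have "ln (real i) \<le> ln (real j)" "0 \<le> ln (real i)" using assms by auto
  then show ?thesis unfolding reserve_def using assms by (intro add_mono mult_left_mono ln_mono) (auto intro: add_pos_nonneg)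
qed

lemma jump_bounds:
  assumes "1 \<le> j"
  shows "golden_gap * (real (peak (Suc j)) - real (peak j)) + 2 * reserve j \<le> ln 2 * real (jump j)"
    and "ln 2 * real (jump j) \<le> golden_gap * (real (peak (Suc j)) - real (peak j)) + 2 * reserve j + ln 2"
proof -
  let ?z = "golden_gap * (real (peak (Suc j)) - real (peak j)) + 2 * reserve j"
  have "0 \<le> ?z" using peak_less[of j] golden_gap_pos reserve_nonneg[OF assms] by simp
  then have "0 \<le> ?z / ln 2" by simp
  then have "?z / ln 2 \<le> real (jump j)" "real (jump j) \<le> ?z / ln 2 + 1" unfolding jump_def by linarith+
  then show "?z \<le> ln 2 * real (jump j)" "ln 2 * real (jump j) \<le> ?z + ln 2"
    by (simp_all add: pos_divide_le_eq pos_le_divide_eq field_simps)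
qed

text \<open>Peaks are strictly increasing integers, so at most one is passed per step and the single
  comparison in the recursion suffices.\<close>

lemma peaks_upto_bounds: "peak (peaks_upto n) \<le> n" "n < peak (Suc (peaks_upto n))"
proof (induction n)
  case 0
  {
    case 1
    show ?case by (simp add: peak_0)
  next
    case 2
    show ?case using peak_1 by simp
  }
next
  case (Suc n)
  {
    case 1
    show ?case using Suc by simp
  next
    case 2
    show ?case using Suc(2) peak_less[of "Suc (peaks_upto n)"] by simp
  }
qed

lemma filterlim_peaks_upto: "filterlim peaks_upto at_top sequentially"
  unfolding filterlim_at_top
proof
  fix R
  have mono: "peak i \<le> peak j" if "i \<le> j" for i j
    using lift_Suc_mono_le[of peak, OF less_imp_le[OF peak_less] that] .
  show "\<forall>\<^sub>F n in sequentially. R \<le> peaks_upto n"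
    using eventually_ge_at_top[of "peak R"]
  proof eventually_elim
    case (elim n)
    show ?case
    proof (rule ccontr)
      assume "\<not> R \<le> peaks_upto n"
      then have "peak (Suc (peaks_upto n)) \<le> peak R" by (intro mono) simp
      then show False using elim peaks_upto_bounds(2)[of n] by simp
    qed
  qed
qed

lemma peak_word_Suc:
  "peaks_upto (Suc n) = Suc (peaks_upto n) \<and> peak_word (Suc n) = 1 + jump (Suc (peaks_upto n)) \<or>
   peaks_upto (Suc n) = peaks_upto n \<and> peak_word (Suc n) = 1"
proof (cases "peak (Suc (peaks_upto n)) \<le> Suc n")
  case True
  then have "peak (Suc (peaks_upto n)) = Suc n" using peaks_upto_bounds(2)[of n] by simp
  then show ?thesis using True by (simp add: peak_word_def)
next
  case False
  then show ?thesis using peaks_upto_bounds(1)[of n] by (simp add: peak_word_def)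
qed

lemma sum_peak_word: "sum peak_word {1..n} = n + sum jump {1..peaks_upto n}"
proof (induction n)
  case (Suc n)
  then show ?case using peak_word_Suc[of n] by (auto simp del: peaks_upto.simps(2))
qed simp

lemma prod_peak_word:
  "(\<Prod>i=1..n. 1 + (real (peak_word i) - 1) / c) = (\<Prod>j=1..peaks_upto n. 1 + real (jump j) / c)"
proof (induction n)
  case (Suc n)
  then show ?case using peak_word_Suc[of n] by (auto simp del: peaks_upto.simps(2))
qed simp

section \<open>Asymptotic estimates for the peaks\<close>

lemma filterlim_sum_at_bot:
  fixes c :: "nat \<Rightarrow> real"
  assumes "\<forall>\<^sub>F j in sequentially. c j \<le> - 1"
  shows "filterlim (\<lambda>m. \<Sum>j=1..m. c j) at_bot sequentially"
proof -
  obtain J where J: "\<And>j. J \<le> j \<Longrightarrow> c j \<le> - 1"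
    using assms unfolding eventually_sequentially by blast
  have le: "(\<Sum>j=1..m. c j) \<le> (\<Sum>j=1..J. c j) + real J - real m" if "J \<le> m" for m
    using that
  proof (induction m rule: dec_induct)
    case (step m)
    then show ?case using J[of "Suc m"] by simp
  qed simp
  have "filterlim (\<lambda>m. C - real m) at_bot sequentially" for C :: real
    by real_asymp
  from this[of "(\<Sum>j=1..J. c j) + real J"] show ?thesis
    by (rule filterlim_at_bot_mono) (rule eventually_mono[OF eventually_ge_at_top[of J] le])
qed

text \<open>The logarithm of the unfolded upper bound for a jump is ln j + ln ln j + O(1), while the
  reserve contains ln ln j twice; the difference tends to minus infinity.\<close>

lemma jump_cost_asymptotics:
  fixes l :: real
  assumes "l > 0"
  shows "\<forall>\<^sub>F j :: nat in sequentially.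
    ln (1 + ((2 + (real j + 1)\<^sup>2 * ln (real j + 1) - (real j)\<^sup>2 * ln (real j) + 2 * (ln (real j) + 2 * ln (1 + ln (real j)))) / ln 2 + 1) / l)
    - (ln (real j) + 2 * ln (1 + ln (real j))) \<le> -1"
  using assms by real_asymp

text \<open>Both sides are 4 m ln m to leading order. The terms of order m ln ln m decide:
  coefficient 4 on the left, 65 on the right, of which 64 come from the factor
  \<open>2 ^ 5\<close>.\<close>

lemma excess_asymptotics:
  fixes g :: real
  assumes "g > 0"
  shows "\<forall>\<^sub>F m :: nat in sequentially.
    (2 + (real m + 1)\<^sup>2 * ln (real m + 1) - (real m)\<^sup>2 * ln (real m)) + 2 * (real m * (ln (real m) + 2 * ln (1 + ln (real m)))) + real m * ln 2
    \<le> sqrt (8 * ((real m)\<^sup>2 * ln (real m)) * ln ((real m)\<^sup>2 * ln (real m) / g)) *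
    (1 + 2 ^ 5 * (ln (ln ((real m)\<^sup>2 * ln (real m) / g)) / ln ((real m)\<^sup>2 * ln (real m) / g)))"
    and "\<forall>\<^sub>F m :: nat in sequentially. exp 1 \<le> (real m)\<^sup>2 * ln (real m) / g"
  using assms by real_asymp+

lemma jump_cost_at_bot:
  "filterlim (\<lambda>m. \<Sum>j=1..m. ln (1 + real (jump j) / lambda1) - reserve j) at_bot sequentially"
proof (rule filterlim_sum_at_bot)
  have l: "lambda1 > 0" using lambda1_bounds by simp
  note jump_cost_asymptotics[OF l]
  then show "\<forall>\<^sub>F j in sequentially. ln (1 + real (jump j) / lambda1) - reserve j \<le> - 1"
    using eventually_ge_at_top[of 1]
  proof eventually_elim
    case (elim j)
    have "ln 2 * real (jump j) \<le> 2 + square_log (Suc j) - square_log j + 2 * reserve j + ln 2"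
      using jump_bounds(2)[OF elim(2)] peak_gap_le[of j] by linarith
    then have "real (jump j) \<le> (2 + square_log (Suc j) - square_log j + 2 * reserve j) / ln 2 + 1"
      by (simp add: field_simps)
    then have "ln (1 + real (jump j) / lambda1) \<le>
      ln (1 + ((2 + square_log (Suc j) - square_log j + 2 * reserve j) / ln 2 + 1) / lambda1)"
      using l by (intro ln_mono add_left_mono divide_right_mono) (auto intro: add_pos_nonneg)
    then show ?case using elim(1) by (simp add: square_log_def reserve_def add.commute)
  qed
qed

section \<open>The peak word: vanishing ratios and small excess\<close>

interpretation peak: cf_word peak_word
  by unfold_locales (simp add: peak_word_def)

lemma sum_peak_differences:
  "(\<Sum>j=1..m. golden_gap * (real (peak (Suc j)) - real (peak j))) = golden_gap * (real (peak (Suc m)) - 1)"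
  using sum_Suc_diff[of 1 m "\<lambda>j. real (peak j)"] peak_1 by (simp add: sum_distrib_left[symmetric])

text \<open>The jumps so far pay \<open>golden_gap\<close> per step up to the next peak, hence
  beyond n, except for the one step before the first peak. What remains is
  \<open>golden_gap + 2 * C m\<close>, where \<open>C m\<close> compares the logarithmic cost of the
  jumps with the reserves and tends to minus infinity.\<close>

lemma peak_ratio_tendsto_zero:
  "(\<lambda>n. (real (cden peak_word (Suc n)))\<^sup>2 / 2 ^ sum peak_word {1..n}) \<longlonglongrightarrow> 0"
proof -
  have l: "lambda1 > 0" using lambda1_bounds by simp
  define C where "C m = (\<Sum>j=1..m. ln (1 + real (jump j) / lambda1) - reserve j)" for m
  have bound: "(real (cden peak_word (Suc n)))\<^sup>2 / 2 ^ sum peak_word {1..n} \<le> exp (golden_gap + 2 * C (peaks_upto n))" for n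
  proof -
    define m where "m = peaks_upto n"
    define G where "G = (\<Prod>j=1..m. 1 + real (jump j) / lambda1)"
    have G: "G > 0" unfolding G_def using l by (intro prod_pos) (auto intro: add_pos_nonneg)
    have lnG: "ln G = (\<Sum>j=1..m. ln (1 + real (jump j) / lambda1))" unfolding G_def
    proof (rule ln_prod)
      fix j
      have "0 \<le> real (jump j) / lambda1" using l by simp
      then show "1 + real (jump j) / lambda1 \<noteq> 0" by linarith
    qed simp
    have q: "real (cden peak_word (Suc n)) \<le> lambda1 ^ n * G"
      using peak.Q_le_golden_norm[of n] peak.golden_norm_upper[of n] unfolding prod_peak_word G_def m_def by linarith
    have "ln ((lambda1 ^ n * G)\<^sup>2 / 2 ^ sum peak_word {1..n}) =
        2 * (real n * ln lambda1 + ln G) - ln 2 * real (sum peak_word {1..n})"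
      using l G by (simp add: ln_div ln_realpow ln_mult)
    also have "\<dots> = golden_gap * real n + 2 * ln G - (\<Sum>j=1..m. ln 2 * real (jump j))"
      unfolding sum_peak_word m_def[symmetric] by (simp add: golden_gap_def algebra_simps sum_distrib_left)
    also have "\<dots> \<le> golden_gap * real (peak (Suc m)) + 2 * ln G -
       (\<Sum>j=1..m. golden_gap * (real (peak (Suc j)) - real (peak j)) + 2 * reserve j)"
      using peaks_upto_bounds(2)[of n] golden_gap_pos
      by (intro diff_mono add_mono mult_left_mono sum_mono jump_bounds) (auto simp: m_def)
    also have "\<dots> = golden_gap + 2 * C m"
      unfolding sum.distrib sum_peak_differences lnG C_def
      by (simp add: sum_subtractf sum_distrib_left algebra_simps)
    finally have "exp (ln ((lambda1 ^ n * G)\<^sup>2 / 2 ^ sum peak_word {1..n})) \<le> exp (golden_gap + 2 * C m)"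
      by (simp only: exp_le_cancel_iff)
    moreover have "0 < (lambda1 ^ n * G)\<^sup>2 / 2 ^ sum peak_word {1..n}" using l G by simp
    ultimately have "(lambda1 ^ n * G)\<^sup>2 / 2 ^ sum peak_word {1..n} \<le> exp (golden_gap + 2 * C m)"
      by (simp only: exp_ln)
    moreover have "(real (cden peak_word (Suc n)))\<^sup>2 / 2 ^ sum peak_word {1..n} \<le> (lambda1 ^ n * G)\<^sup>2 / 2 ^ sum peak_word {1..n}"
      using q by (intro divide_right_mono power_mono) auto
    ultimately show ?thesis by (simp add: m_def)
  qed
  have "filterlim (\<lambda>n. C (peaks_upto n)) at_bot sequentially"
    using filterlim_compose[OF jump_cost_at_bot filterlim_peaks_upto] by (simp add: C_def)
  then have "(\<lambda>n. exp (C (peaks_upto n))) \<longlonglongrightarrow> 0"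
    by (rule filterlim_compose[OF exp_at_bot])
  then have "(\<lambda>n. exp golden_gap * (exp (C (peaks_upto n)))\<^sup>2) \<longlonglongrightarrow> exp golden_gap * 0\<^sup>2"
    by (intro tendsto_intros)
  then have "(\<lambda>n. exp (golden_gap + 2 * C (peaks_upto n))) \<longlonglongrightarrow> 0"
    by (simp add: exp_add exp_double)
  then show ?thesis
    by (rule tendsto_sandwich[OF always_eventually always_eventually tendsto_const, rotated 2])
      (use bound in simp_all)
qed

text \<open>After expanding, the expression is a sum of products of \<open>sqrt (w * ln w)\<close>,
  \<open>sqrt (w / ln w)\<close> and \<open>ln (ln w)\<close>, all nonnegative and increasing for
  \<open>w \<ge> exp 1\<close>.\<close>

lemma profile_mono:
  fixes u v :: real
  assumes "exp 1 \<le> u" "u \<le> v"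
  shows "sqrt (u * ln u) * (1 + 2 ^ 5 * (ln (ln u) / ln u)) \<le> sqrt (v * ln v) * (1 + 2 ^ 5 * (ln (ln v) / ln v))"
proof -
  have pos: "0 < u" "0 < v" using assms less_le_trans[OF exp_gt_zero] by (blast intro: less_le_trans)+
  have ln: "1 \<le> ln u" "ln u \<le> ln v" using assms pos by (auto simp: ln_ge_iff)
  have eq: "sqrt (w * ln w) * (1 + 2 ^ 5 * (ln (ln w) / ln w)) = sqrt (w * ln w) + 2 ^ 5 * (sqrt (w / ln w) * ln (ln w))"
    if "0 < w" "1 \<le> ln w" for w :: real
  proof -
    have "\<bar>ln w\<bar> = ln w" using that by simp
    then have "sqrt (w * ln w) / ln w = sqrt (w * ln w / (ln w)\<^sup>2)"
      by (simp add: real_sqrt_divide)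
    also have "\<dots> = sqrt (w / ln w)" using that by (simp add: power2_eq_square)
    finally have "sqrt (w * ln w) / ln w = sqrt (w / ln w)" .
    moreover have "sqrt (w * ln w) * (1 + 2 ^ 5 * (ln (ln w) / ln w)) =
      sqrt (w * ln w) + 2 ^ 5 * (sqrt (w * ln w) / ln w * ln (ln w))"
      by (simp add: distrib_left)
    ultimately show ?thesis by (simp only:)
  qed
  have "ln v / v \<le> ln u / u" by (rule ln_x_over_x_mono[OF assms])
  moreover have "0 < ln u" "0 < ln v" using ln by linarith+
  ultimately have "u / ln u \<le> v / ln v" using pos by (simp add: field_simps)
  moreover have "ln (ln u) \<le> ln (ln v)" using ln by simp
  moreover have "0 \<le> ln (ln u)" using ln by simp
  moreover have "0 \<le> v / ln v" using ln pos by (intro divide_nonneg_nonneg) linarith+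
  ultimately have "sqrt (u / ln u) * ln (ln u) \<le> sqrt (v / ln v) * ln (ln v)"
    by (intro mult_mono real_sqrt_le_mono) auto
  moreover have "sqrt (u * ln u) \<le> sqrt (v * ln v)"
    using pos ln assms by (intro real_sqrt_le_mono mult_mono) linarith+
  moreover have "1 \<le> ln v" using ln by linarith
  ultimately show ?thesis unfolding eq[OF pos(1) ln(1)] eq[OF pos(2) \<open>1 \<le> ln v\<close>]
    by (intro add_mono mult_left_mono) simp_all
qed

text \<open>Every partial quotient 1 lowers the excess, so the last peak is the worst case. There
  the loss paid in advance until the next peak and the accumulated reserves each contribute about 2
  m ln m to \<open>ln 2\<close> times the excess.\<close>

lemma peak_excess_upper:
  "\<forall>\<^sub>F t in sequentially. peak.excess t \<le> sqrt (8 * golden_gap) / ln 2 * sqrt (real t * ln (real t))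
      * (1 + 2 ^ 5 * (ln (ln (real t)) / ln (real t)))"
proof -
  note g = golden_gap_pos
  note excess_asymptotics[OF g]
  moreover have "\<forall>\<^sub>F m :: nat in sequentially. 1 \<le> m" by (rule eventually_ge_at_top)
  ultimately have "\<forall>\<^sub>F m in sequentially. \<forall>t. peaks_upto t = m \<longrightarrow>
    peak.excess t \<le> sqrt (8 * golden_gap) / ln 2 * sqrt (real t * ln (real t))
      * (1 + 2 ^ 5 * (ln (ln (real t)) / ln (real t)))"
  proof eventually_elim
    case (elim m)
    show ?case
    proof (intro allI impI)
      fix t assume m: "peaks_upto t = m"
      \<comment> \<open>A lower bound for t depending on m alone; since the claimed bound increases,
        it suffices to reach its value at u.\<close>
      define u where "u = square_log m / golden_gap"
      have t: "peak m \<le> t" using peaks_upto_bounds(1)[of t] m by simp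
      have ut: "u \<le> real t" using peak_bounds(1)[of m] t by (simp add: u_def)
      have u: "exp 1 \<le> u" using elim(2) by (simp add: u_def square_log_def)
      have "ln 2 * peak.excess t = (\<Sum>j=1..m. ln 2 * real (jump j)) - golden_gap * real t"
        unfolding peak.excess_def sum_peak_word m by (simp add: kappa1_eq field_simps sum_distrib_left)
      also have "\<dots> \<le> (\<Sum>j=1..m. golden_gap * (real (peak (Suc j)) - real (peak j)) + (2 * reserve m + ln 2))
         - golden_gap * real (peak m)"
      proof (intro diff_mono sum_mono)
        fix j assume j: "j \<in> {1..m}"
        show "ln 2 * real (jump j) \<le> golden_gap * (real (peak (Suc j)) - real (peak j)) + (2 * reserve m + ln 2)"
          using jump_bounds(2)[of j] reserve_mono[of j m] j by simp
      qed (use t g in auto)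
      also have "\<dots> = golden_gap * (real (peak (Suc m)) - real (peak m)) - golden_gap + (2 * (real m * reserve m) + real m * ln 2)"
        unfolding sum.distrib sum_peak_differences by (simp add: algebra_simps)
      also have "\<dots> \<le> 2 + square_log (Suc m) - square_log m + 2 * (real m * reserve m) + real m * ln 2"
        using peak_gap_le[of m] g by linarith
      also have "\<dots> \<le> sqrt (8 * square_log m * ln u) * (1 + 2 ^ 5 * (ln (ln u) / ln u))"
        using elim(1) by (simp add: square_log_def reserve_def u_def add.commute)
      also have "sqrt (8 * square_log m * ln u) = sqrt (8 * golden_gap) * sqrt (u * ln u)"
        using g by (simp add: u_def real_sqrt_mult[symmetric])
      also have "\<dots> * (1 + 2 ^ 5 * (ln (ln u) / ln u)) \<le> sqrt (8 * golden_gap) * (sqrt (real t * ln (real t)) * (1 + 2 ^ 5 * (ln (ln (real t)) / ln (real t))))"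
        unfolding mult.assoc using g by (intro mult_left_mono profile_mono[OF u ut]) auto
      finally show "peak.excess t \<le> sqrt (8 * golden_gap) / ln 2 * sqrt (real t * ln (real t))
        * (1 + 2 ^ 5 * (ln (ln (real t)) / ln (real t)))"
        by (simp add: pos_le_divide_eq mult_ac)
    qed
  qed
  \<comment> \<open>As \<open>peaks_upto t\<close> tends to infinity, what holds for all t over
    large m holds for all large t.\<close>
  from filterlim_iff[THEN iffD1, OF filterlim_peaks_upto, rule_format, OF this]
  show ?thesis by (auto elim: eventually_mono)
qed

lemma exists_small_pq_sum_excess:
  "\<exists>x::real. x \<in> {0<..<1} \<and> x \<notin> \<rat> \<and> (question_mark has_real_derivative 0) (at x) \<and>
     (\<exists>T. \<forall>t\<ge>T. real_of_int (pq_sum x t) - kappa1 * real t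
        \<le> sqrt (16 * ln lambda1 - 8 * ln 2) / ln 2 * sqrt (real t * ln (real t))
          * (1 + 2 ^ 5 * (ln (ln (real t)) / ln (real t))))"
proof -
  obtain r where "cf_expansion peak_word r" using peak.cf_expansion_exists by blast
  then interpret cf_expansion peak_word r .
  have c: "sqrt (16 * ln lambda1 - 8 * ln 2) = sqrt (8 * golden_gap)"
    by (simp add: golden_gap_def)
  have "peak.excess t = real_of_int (pq_sum (r 0) t) - kappa1 * real t" for t
    unfolding pq_sum_r peak.excess_def by (simp only: of_int_of_nat_eq)
  then show ?thesis
    using r_bounds[of 0] r_irrational derivative_zeroI[OF peak_ratio_tendsto_zero] peak_excess_upper
    unfolding c eventually_sequentially by (intro exI[of _ "r 0"]) auto
qed

theorem theorem2:
  shows "(\<forall>x::real. x \<in> {0<..<1} \<and> x \<notin> \<rat> \<and> (question_mark has_real_derivative 0) (at x) \<longrightarrow>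
            (\<forall>\<psi> :: nat \<Rightarrow> real.
               (\<forall>t\<ge>1. 0 \<le> \<psi> t) \<and> \<psi> \<in> o(\<lambda>t. ln (ln (real t)) / ln (real t)) \<longrightarrow>
               (\<exists>T. \<forall>t\<ge>T.
                  Max ((\<lambda>u. real_of_int (pq_sum x u) - kappa1 * real u) ` {1..t})
                    \<ge> sqrt (2 * ln lambda1 - ln 2) / ln 2 * sqrt (real t * ln (real t))
                      * (1 - real t powr (- \<psi> t)))))
       \<and> (\<exists>x::real. x \<in> {0<..<1} \<and> x \<notin> \<rat> \<and> (question_mark has_real_derivative 0) (at x) \<and>
            (\<exists>T. \<forall>t\<ge>T.
               real_of_int (pq_sum x t) - kappa1 * real t
                 \<le> sqrt (16 * ln lambda1 - 8 * ln 2) / ln 2 * sqrt (real t * ln (real t))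
                   * (1 + 2 ^ 5 * (ln (ln (real t)) / ln (real t)))))"
proof (intro conjI allI impI)
  fix x :: real and \<psi> :: "nat \<Rightarrow> real"
  assume "x \<in> {0<..<1} \<and> x \<notin> \<rat> \<and> (question_mark has_real_derivative 0) (at x)"
  then obtain T where T: "\<And>t. T \<le> t \<Longrightarrow> sqrt (2 * ln lambda1 - ln 2) / ln 2 * sqrt (real t * ln (real t))
     \<le> Max ((\<lambda>u. real_of_int (pq_sum x u) - kappa1 * real u) ` {1..t})"
    using Max_pq_sum_excess_lower by blast
  \<comment> \<open>The lower bound obtained above carries no error factor, and
    \<open>1 - t powr (- \<psi> t)\<close> is at most 1.\<close>
  have "sqrt (2 * ln lambda1 - ln 2) / ln 2 * sqrt (real t * ln (real t)) * (1 - real t powr (- \<psi> t)) \<le>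
      sqrt (2 * ln lambda1 - ln 2) / ln 2 * sqrt (real t * ln (real t))" for t
  proof -
    have "0 \<le> real t * ln (real t)" by (cases t) auto
    then have "0 \<le> sqrt (2 * ln lambda1 - ln 2) / ln 2 * sqrt (real t * ln (real t))"
      using golden_gap_pos by (simp add: golden_gap_def)
    from mult_left_mono[OF _ this, of "1 - real t powr (- \<psi> t)" 1] show ?thesis by simp
  qed
  with T show "\<exists>T. \<forall>t\<ge>T. Max ((\<lambda>u. real_of_int (pq_sum x u) - kappa1 * real u) ` {1..t})
      \<ge> sqrt (2 * ln lambda1 - ln 2) / ln 2 * sqrt (real t * ln (real t)) * (1 - real t powr (- \<psi> t))"
    by (meson order_trans)
qed (rule exists_small_pq_sum_excess)

end
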